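(* Consider the family of hypersurfaces $(M^3_\Gamma\cap M^4,h_0)$, where $\Gamma$ is an arbitrary curve, with the spin structure determined by the global frame $\{Y_1,Y_2,Y_3\}$. Let $\lambda\in\mathbb R$. Then $$\psi=\frac{1}{\rho\sqrt{r^2+1}}\begin{pmatrix}e^{-i\lambda\sqrt{2(r^2+1)}\,\rho}\\ e^{\,i\lambda\sqrt{2(r^2+1)}\,\rho}\end{pmatrix}$$ is a WK spinor with WK number $\lambda$ and length $|\psi|^2=-2S$, where $S$ is the scalar curvature. Thus (for $\lambda\ne0$) the normalized spinor $$\sqrt{\frac{-S}{|\lambda|\,|\psi|^2}}\;\psi=\frac{1}{\rho\sqrt{2(r^2+1)|\lambda|}}\begin{pmatrix}e^{-i\lambda\sqrt{2(r^2+1)}\,\rho}\\ e^{\,i\lambda\sqrt{2(r^2+1)}\,\rho}\end{pmatrix}$$ is an Einstein spinor on $M^3_\Gamma\cap M^4$ with eigenvalue $\lambda$.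
   Context: $M^4=(\mathbb C^2\setminus\{0\})/\{\pm1\}$ with coordinates $\pm(z_1,z_2)$ and the metric $g_0(X,Y)=\omega_0(X,JY)$, $\omega_0=i\partial\bar\partial u_1$, $u_1=|z_1|^2+|z_2|^2$ (i.e. twice the flat metric; this is the $t=0$ member of the Eguchi--Hanson family). $\Gamma(s)=u(s)+iv(s)=r(s)e^{i\phi_\Gamma(s)}$ is a smooth curve in $\mathbb C$ parametrized by Euclidean arc length. $M^3_\Gamma\cap M^4\subset M^4$ is the hypersurface of points with $z_1/z_2\in\Gamma$, parametrized by $(s,\rho,\phi)$, $\rho>0$, via $\pm(z_1,z_2)=\pm\rho e^{i\phi}(\Gamma(s),1)$; $h_0$ is the induced metric. Its scalar curvature is $S=-1/(\rho^2(r^2+1))$. Frame (with $K=2$): $h_{12}=2r\dot r\rho$, $h_{13}=2\dot\phi_\Gamma r^2\rho^2$, $h_{22}=2(r^2+1)$, $h_{33}=2\rho^2(r^2+1)$, $\Sigma=1/(2\rho\sqrt{h_{22}})$, $Y_1=h_{22}^{-1/2}\partial_\rho$, $Y_2=h_{33}^{-1/2}\partial_\phi$, $Y_3=\Sigma\,(h_{22}\partial_s-h_{12}\partial_\rho-\rho^{-2}h_{13}\partial_\phi)$; this is a global orthonormal frame. Using the spin structure it determines, spinor fields are $\mathbb C^2$-valued functions, Clifford multiplication by $Y_1,Y_2,Y_3$ is by the matrices $\begin{pmatrix}i&0\\0&-i\end{pmatrix}$, $\begin{pmatrix}0&i\\i&0\end{pmatrix}$, $\begin{pmatrix}0&-1\\1&0\end{pmatrix}$,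 and $\nabla\psi=d\psi+\frac12\sum_{i<j}\omega_{ij}Y_i\cdot Y_j\cdot\psi$ with $\omega_{ij}=h_0(\nabla Y_i,Y_j)$; $\mathrm D\psi=\sum_iY_i\cdot\nabla_{Y_i}\psi$. WK spinor with WK number $\lambda$ (dimension $n=3$, $S$ nowhere zero): a non-trivial spinor field with $4S\,\nabla_X\psi=3\,dS(X)\psi+4\lambda(2\mathrm{Ric}(X)-S X)\cdot\psi+X\cdot dS\cdot\psi$ for all $X$ ($dS$ identified with $\mathrm{grad}\,S$). Einstein spinor with eigenvalue $\lambda$: a non-trivial spinor field with $\mathrm D\psi=\lambda\psi$ and $\mathrm{Ric}-\frac12S h_0=\pm\frac14T_\psi$ for one choice of sign (positive resp. negative Einstein spinor), $T_\psi(X,Y)=\mathrm{Re}\langle X\cdot\nabla_Y\psi+Y\cdot\nabla_X\psi,\psi\rangle$. *)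

theory Defs
  imports "HOL-Analysis.Analysis"
begin

section \<open>Smooth maps on open sets\<close>

text \<open>\<open>times_differentiable_on n\<close> means \<open>C\<^sup>n\<close>, through iterated directional derivatives, on an open subset
  of a Euclidean space.\<close>

primrec times_differentiable_on ::
  "nat \<Rightarrow> 'a::real_normed_vector set \<Rightarrow> ('a \<Rightarrow> 'b::real_normed_vector) \<Rightarrow> bool" where
  "times_differentiable_on 0 U f \<longleftrightarrow> continuous_on U f"
| "times_differentiable_on (Suc n) U f \<longleftrightarrow>
     (\<forall>x\<in>U. f differentiable at x) \<and>
     (\<forall>v. times_differentiable_on n U (\<lambda>x. frechet_derivative f (at x) v))"

definition smooth_on :: "'a::real_normed_vector set \<Rightarrow> ('a \<Rightarrow> 'b::real_normed_vector) \<Rightarrow> bool" where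
  "smooth_on U f \<longleftrightarrow> (\<forall>n. times_differentiable_on n U f)"


section \<open>Riemannian geometry in a coordinate domain\<close>

text \<open>A metric is given by its matrix \<open>g p\<close> of components with respect to the coordinate vector
  fields; tangent vectors and vector fields are given by their coordinate components.\<close>

definition partial :: "'n::finite \<Rightarrow> (real^'n \<Rightarrow> 'b::real_normed_vector) \<Rightarrow> real^'n \<Rightarrow> 'b" where
  "partial i f p = frechet_derivative f (at p) (axis i 1)"

definition metric :: "real^'n^'n \<Rightarrow> real^'n \<Rightarrow> real^'n \<Rightarrow> real" where
  "metric G X Y = (\<Sum>i\<in>UNIV. \<Sum>j\<in>UNIV. G $ i $ j * X $ i * Y $ j)"

definition christoffel ::
  "(real^'n \<Rightarrow> real^'n^'n) \<Rightarrow> 'n::finite \<Rightarrow> 'n \<Rightarrow> 'n \<Rightarrow> real^'n \<Rightarrow> real" where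
  "christoffel g k i j p = 1/2 * (\<Sum>l\<in>UNIV. matrix_inv (g p) $ k $ l *
     (partial i (\<lambda>q. g q $ j $ l) p + partial j (\<lambda>q. g q $ i $ l) p
      - partial l (\<lambda>q. g q $ i $ j) p))"

text \<open>The Levi-Civita derivative of the vector field \<open>Y\<close> in the direction of the tangent vector
  \<open>X\<close> at the point \<open>p\<close>.\<close>

definition levi_civita ::
  "(real^'n \<Rightarrow> real^'n^'n) \<Rightarrow> real^'n \<Rightarrow> (real^'n \<Rightarrow> real^'n) \<Rightarrow> real^'n \<Rightarrow> real^'n" where
  "levi_civita g X Y p = (\<chi> k. \<Sum>i\<in>UNIV. X $ i *
     (partial i (\<lambda>q. Y q $ k) p + (\<Sum>j\<in>UNIV. christoffel g k i j p * Y p $ j)))"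

text \<open>The field \<open>R(\<partial>\<^sub>i, \<partial>\<^sub>j)\<partial>\<^sub>k\<close>, where \<open>R(X,Y)Z = \<nabla>\<^sub>X\<nabla>\<^sub>Y Z - \<nabla>\<^sub>Y\<nabla>\<^sub>X Z - \<nabla>\<^bsub>[X,Y]\<^esub> Z\<close>; coordinate
  fields commute.\<close>

definition curvature ::
  "(real^'n \<Rightarrow> real^'n^'n) \<Rightarrow> 'n::finite \<Rightarrow> 'n \<Rightarrow> 'n \<Rightarrow> real^'n \<Rightarrow> real^'n" where
  "curvature g i j k p =
     levi_civita g (axis i 1) (levi_civita g (axis j 1) (\<lambda>_. axis k 1)) p
     - levi_civita g (axis j 1) (levi_civita g (axis i 1) (\<lambda>_. axis k 1)) p"

text \<open>\<open>Ric(Y,Z)\<close> is the trace of \<open>X \<mapsto> R(X,Y)Z\<close>, so that round spheres have positive Ricci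
  curvature.\<close>

definition ricci :: "(real^'n \<Rightarrow> real^'n^'n) \<Rightarrow> real^'n \<Rightarrow> real^'n^'n" where
  "ricci g p = (\<chi> j k. \<Sum>i\<in>UNIV. curvature g i j k p $ i)"

definition scalar_curvature :: "(real^'n \<Rightarrow> real^'n^'n) \<Rightarrow> real^'n \<Rightarrow> real" where
  "scalar_curvature g p = (\<Sum>j\<in>UNIV. \<Sum>k\<in>UNIV. matrix_inv (g p) $ j $ k * ricci g p $ j $ k)"

definition ricci_endo :: "(real^'n \<Rightarrow> real^'n^'n) \<Rightarrow> real^'n \<Rightarrow> real^'n \<Rightarrow> real^'n" where
  "ricci_endo g p X = matrix_inv (g p) *v (ricci g p *v X)"

definition gradient :: "(real^'n \<Rightarrow> real^'n^'n) \<Rightarrow> (real^'n \<Rightarrow> real) \<Rightarrow> real^'n \<Rightarrow> real^'n" where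
  "gradient g f p = matrix_inv (g p) *v (\<chi> k. partial k f p)"


section \<open>Spinors with respect to a global orthonormal frame in dimension three\<close>

text \<open>\<open>Y 1, Y 2, Y 3\<close> is the frame. Beware that the type \<open>3\<close> is the ring of integers modulo 3,
  in which \<open>3 = 0\<close>.\<close>

definition clifford_matrix :: "3 \<Rightarrow> complex^2^2" where
  "clifford_matrix i =
     (if i = 1 then vector [vector [\<i>, 0], vector [0, - \<i>]]
      else if i = 2 then vector [vector [0, \<i>], vector [\<i>, 0]]
      else vector [vector [0, - 1], vector [1, 0]])"

text \<open>Clifford multiplication by \<open>X = \<Sum> g(X, Y i) Y i\<close>.\<close>

definition clifford ::
  "(real^3 \<Rightarrow> real^3^3) \<Rightarrow> (3 \<Rightarrow> real^3 \<Rightarrow> real^3) \<Rightarrow> real^3 \<Rightarrow> real^3 \<Rightarrow> complex^2 \<Rightarrow> complex^2" where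
  "clifford g Y p X \<phi> = (\<Sum>i\<in>UNIV. metric (g p) X (Y i p) *\<^sub>R (clifford_matrix i *v \<phi>))"

definition spin_derivative ::
  "(real^3 \<Rightarrow> real^3^3) \<Rightarrow> (3 \<Rightarrow> real^3 \<Rightarrow> real^3) \<Rightarrow> real^3 \<Rightarrow> (real^3 \<Rightarrow> complex^2) \<Rightarrow> real^3 \<Rightarrow> complex^2"
  where
  "spin_derivative g Y X \<psi> p = frechet_derivative \<psi> (at p) X +
     (1/2) *\<^sub>R (\<Sum>(i, j)\<in>{(1,2), (1,3), (2,3)}.
        metric (g p) (levi_civita g X (Y i) p) (Y j p) *\<^sub>R
          (clifford_matrix i *v (clifford_matrix j *v \<psi> p)))"

definition dirac ::
  "(real^3 \<Rightarrow> real^3^3) \<Rightarrow> (3 \<Rightarrow> real^3 \<Rightarrow> real^3) \<Rightarrow> (real^3 \<Rightarrow> complex^2) \<Rightarrow> real^3 \<Rightarrow> complex^2" where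
  "dirac g Y \<psi> p = (\<Sum>i\<in>UNIV. clifford_matrix i *v spin_derivative g Y (Y i p) \<psi> p)"

text \<open>The inner product of \<open>complex^2\<close> is the real part of the Hermitian one.\<close>

definition energy_momentum ::
  "(real^3 \<Rightarrow> real^3^3) \<Rightarrow> (3 \<Rightarrow> real^3 \<Rightarrow> real^3) \<Rightarrow> (real^3 \<Rightarrow> complex^2) \<Rightarrow>
     real^3 \<Rightarrow> real^3 \<Rightarrow> real^3 \<Rightarrow> real" where
  "energy_momentum g Y \<psi> p X Z =
     (clifford g Y p X (spin_derivative g Y Z \<psi> p) + clifford g Y p Z (spin_derivative g Y X \<psi> p))
       \<bullet> \<psi> p"


section \<open>The ambient metric\<close>

text \<open>\<open>M\<^sup>4\<close> is the quotient of \<open>\<complex>\<^sup>2 - {0}\<close> by \<open>z \<mapsto> -z\<close>. The metric is invariant under this map, so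
  all local computations are done upstairs.\<close>

text \<open>The Wirtinger derivatives.\<close>

definition dz :: "2 \<Rightarrow> (complex^2 \<Rightarrow> complex) \<Rightarrow> complex^2 \<Rightarrow> complex" where
  "dz j f z = 1/2 * (frechet_derivative f (at z) (axis j 1)
                     - \<i> * frechet_derivative f (at z) (axis j \<i>))"

definition dzbar :: "2 \<Rightarrow> (complex^2 \<Rightarrow> complex) \<Rightarrow> complex^2 \<Rightarrow> complex" where
  "dzbar j f z = 1/2 * (frechet_derivative f (at z) (axis j 1)
                        + \<i> * frechet_derivative f (at z) (axis j \<i>))"

definition u1 :: "complex^2 \<Rightarrow> complex" where
  "u1 z = of_real ((cmod (z $ 1))\<^sup>2 + (cmod (z $ 2))\<^sup>2)"

text \<open>The form \<open>\<i> \<Sum> dz j (dzbar k u1) dz\<^sub>j \<and> dzbar\<^sub>k\<close> on two real tangent vectors, with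
  \<open>(dz\<^sub>j \<and> dzbar\<^sub>k)(V,W) = V\<^sub>j cnj W\<^sub>k - W\<^sub>j cnj V\<^sub>k\<close>. The value is real.\<close>

definition omega0 :: "complex^2 \<Rightarrow> complex^2 \<Rightarrow> complex^2 \<Rightarrow> real" where
  "omega0 z V W = Re (\<i> * (\<Sum>j\<in>UNIV. \<Sum>k\<in>UNIV. dz j (dzbar k u1) z *
     (V $ j * cnj (W $ k) - W $ j * cnj (V $ k))))"

definition g0 :: "complex^2 \<Rightarrow> complex^2 \<Rightarrow> complex^2 \<Rightarrow> real" where
  "g0 z V W = omega0 z V (\<chi> j. \<i> * W $ j)"

lemma u1_dzbar: "dzbar k u1 = (\<lambda>z. z $ k)"
proof
  fix z :: "complex^2"
  have u: "u1 = (\<lambda>z. of_real (z \<bullet> z))"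
    by (rule ext) (simp add: u1_def inner_vec_def sum_2 dot_square_norm)
  have "(u1 has_derivative (\<lambda>h. of_real (z \<bullet> h + h \<bullet> z))) (at z)"
    unfolding u by (auto intro!: derivative_eq_intros)
  then have "frechet_derivative u1 (at z) = (\<lambda>h. of_real (2 * (z \<bullet> h)))"
    by (subst frechet_derivative_at[symmetric]) (auto simp: inner_commute)
  then show "dzbar k u1 z = z $ k"
    by (simp add: dzbar_def inner_axis complex_eq_iff inner_complex_def)
qed

lemma g0_flat: "g0 z V W = 2 * (V \<bullet> W)"
proof -
  have "frechet_derivative (\<lambda>z::complex^2. z $ k) (at z) = (\<lambda>h. h $ k)" for k
    by (rule frechet_derivative_at[symmetric])
      (auto intro!: derivative_eq_intros bounded_linear_imp_has_derivative bounded_linear_vec_nth)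
  then have "dz j (dzbar k u1) z = (if j = k then 1 else 0)" for j k
    by (simp add: u1_dzbar dz_def axis_def)
  then show ?thesis
    by (simp add: g0_def omega0_def inner_vec_def sum_2 inner_complex_def algebra_simps)
qed


section \<open>The hypersurface\<close>

text \<open>The coordinates of \<open>p :: real^3\<close> are \<open>s = p $ 1\<close>, \<open>\<rho> = p $ 2\<close>, \<open>\<phi> = p $ 3\<close>. The curve \<open>\<Gamma>\<close> is
  defined on an open interval \<open>I\<close>; a closed curve is given by a periodic \<open>\<Gamma>\<close> on the real line.\<close>

definition domain_of :: "real set \<Rightarrow> (real^3) set" where
  "domain_of I = {p. p $ 1 \<in> I \<and> p $ 2 > 0}"

definition immersion :: "(real \<Rightarrow> complex) \<Rightarrow> real^3 \<Rightarrow> complex^2" where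
  "immersion \<Gamma> p = vector [of_real (p $ 2) * cis (p $ 3) * \<Gamma> (p $ 1), of_real (p $ 2) * cis (p $ 3)]"

lemma immersion_image:
  "immersion \<Gamma> ` domain_of I = {z. z $ 2 \<noteq> 0 \<and> z $ 1 / z $ 2 \<in> \<Gamma> ` I}"
proof (intro equalityI subsetI)
  fix z assume "z \<in> immersion \<Gamma> ` domain_of I"
  then show "z \<in> {z. z $ 2 \<noteq> 0 \<and> z $ 1 / z $ 2 \<in> \<Gamma> ` I}"
    by (auto simp: immersion_def domain_of_def)
next
  fix z :: "complex^2" assume "z \<in> {z. z $ 2 \<noteq> 0 \<and> z $ 1 / z $ 2 \<in> \<Gamma> ` I}"
  then obtain s where s: "z $ 2 \<noteq> 0" "s \<in> I" "z $ 1 / z $ 2 = \<Gamma> s" by auto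
  define p :: "real^3" where "p = vector [s, cmod (z $ 2), Arg (z $ 2)]"
  have "of_real (cmod (z $ 2)) * cis (Arg (z $ 2)) = z $ 2"
    by (metis rcis_cmod_Arg rcis_def)
  moreover have "z $ 1 = z $ 2 * \<Gamma> s"
    using s by (simp add: field_simps)
  ultimately have "z = immersion \<Gamma> p"
    by (simp add: vec_eq_iff forall_2 immersion_def p_def)
  moreover have "p \<in> domain_of I"
    using s by (simp add: domain_of_def p_def)
  ultimately show "z \<in> immersion \<Gamma> ` domain_of I" by blast
qed

definition h0 :: "(real \<Rightarrow> complex) \<Rightarrow> real^3 \<Rightarrow> real^3^3" where
  "h0 \<Gamma> p = (\<chi> i j. g0 (immersion \<Gamma> p) (partial i (immersion \<Gamma>) p) (partial j (immersion \<Gamma>) p))"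

definition frame :: "(real \<Rightarrow> complex) \<Rightarrow> 3 \<Rightarrow> real^3 \<Rightarrow> real^3" where
  "frame \<Gamma> i p =
    (let \<rho> = p $ 2; h12 = h0 \<Gamma> p $ 1 $ 2; h13 = h0 \<Gamma> p $ 1 $ 3;
         h22 = h0 \<Gamma> p $ 2 $ 2; h33 = h0 \<Gamma> p $ 3 $ 3; \<Sigma> = 1 / (2 * \<rho> * sqrt h22)
     in if i = 1 then (1 / sqrt h22) *\<^sub>R axis 2 1
        else if i = 2 then (1 / sqrt h33) *\<^sub>R axis 3 1
        else \<Sigma> *\<^sub>R (h22 *\<^sub>R axis 1 1 - h12 *\<^sub>R axis 2 1 - (h13 / \<rho>\<^sup>2) *\<^sub>R axis 3 1))"

lemma partial_immersion:
  assumes "(\<Gamma> has_vector_derivative \<Gamma>') (at (p $ 1))"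
  shows "partial 1 (immersion \<Gamma>) p = vector [of_real (p $ 2) * cis (p $ 3) * \<Gamma>', 0]"
    and "partial 2 (immersion \<Gamma>) p = vector [cis (p $ 3) * \<Gamma> (p $ 1), cis (p $ 3)]"
    and "partial 3 (immersion \<Gamma>) p =
           vector [\<i> * of_real (p $ 2) * cis (p $ 3) * \<Gamma> (p $ 1), \<i> * of_real (p $ 2) * cis (p $ 3)]"
proof -
  have nth: "((\<lambda>q::real^3. q $ k) has_derivative (\<lambda>h. h $ k)) (at p)" for k
    by (rule bounded_linear_imp_has_derivative[OF bounded_linear_vec_nth])
  have G: "((\<lambda>q::real^3. \<Gamma> (q $ 1)) has_derivative (\<lambda>h. (h $ 1) *\<^sub>R \<Gamma>')) (at p)"
    using has_derivative_compose[OF nth[of 1] assms[unfolded has_vector_derivative_def]] .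
  have C: "((\<lambda>q::real^3. cis (q $ 3)) has_derivative (\<lambda>h. (h $ 3) *\<^sub>R (\<i> * cis (p $ 3)))) (at p)"
    by (rule has_derivative_cis[OF nth])
  have R: "((\<lambda>q::real^3. complex_of_real (q $ 2)) has_derivative (\<lambda>h. of_real (h $ 2))) (at p)"
    using nth[of 2] by (rule has_derivative_of_real)
  define D where "D h = (vector [
      of_real (p $ 2) * cis (p $ 3) * ((h $ 1) *\<^sub>R \<Gamma>')
        + (of_real (p $ 2) * ((h $ 3) *\<^sub>R (\<i> * cis (p $ 3))) + of_real (h $ 2) * cis (p $ 3)) * \<Gamma> (p $ 1),
      of_real (p $ 2) * ((h $ 3) *\<^sub>R (\<i> * cis (p $ 3))) + of_real (h $ 2) * cis (p $ 3)] :: complex^2)"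
    for h :: "real^3"
  have RC: "((\<lambda>q::real^3. of_real (q $ 2) * cis (q $ 3)) has_derivative
      (\<lambda>h. of_real (p $ 2) * ((h $ 3) *\<^sub>R (\<i> * cis (p $ 3))) + of_real (h $ 2) * cis (p $ 3))) (at p)"
    by (rule has_derivative_mult[OF R C])
  have "((\<lambda>q. immersion \<Gamma> q $ k) has_derivative (\<lambda>h. D h $ k)) (at p)" for k
  proof -
    have "k = 1 \<or> k = 2" using exhaust_2 by blast
    then show ?thesis
      using has_derivative_mult[OF RC G] RC by (auto simp: immersion_def D_def)
  qed
  then have "(immersion \<Gamma> has_derivative D) (at p)"
    by (subst has_derivative_componentwise_within) (auto simp: Basis_vec_def inner_axis intro: has_derivative_inner_left)
  then have F: "frechet_derivative (immersion \<Gamma>) (at p) = D"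
    by (rule frechet_derivative_at[symmetric])
  show "partial 1 (immersion \<Gamma>) p = vector [of_real (p $ 2) * cis (p $ 3) * \<Gamma>', 0]"
    "partial 2 (immersion \<Gamma>) p = vector [cis (p $ 3) * \<Gamma> (p $ 1), cis (p $ 3)]"
    "partial 3 (immersion \<Gamma>) p =
      vector [\<i> * of_real (p $ 2) * cis (p $ 3) * \<Gamma> (p $ 1), \<i> * of_real (p $ 2) * cis (p $ 3)]"
    by (simp_all add: partial_def F D_def axis_def algebra_simps)
qed

text \<open>In polar coordinates \<open>\<Gamma> = r e\<^bsup>\<i>\<theta>\<^esup>\<close> the components of the metric used in \<open>frame\<close> are the
  expected ones; \<open>r\<close> may change sign, so that curves through the origin are covered. The definition of \<open>frame\<close> through \<open>h0\<close> does not need a choice of \<open>\<theta>\<close>, nor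
  \<open>\<Gamma> \<noteq> 0\<close>.\<close>

lemma h0_components_polar:
  assumes "open I" "p \<in> domain_of I" "\<And>t. t \<in> I \<Longrightarrow> \<Gamma> t = of_real (r t) * cis (\<theta> t)"
    and r: "(r has_real_derivative r') (at (p $ 1))"
    and \<theta>: "(\<theta> has_real_derivative \<theta>') (at (p $ 1))"
  shows "h0 \<Gamma> p $ 1 $ 2 = 2 * r (p $ 1) * r' * p $ 2"
    and "h0 \<Gamma> p $ 1 $ 3 = 2 * \<theta>' * (r (p $ 1))\<^sup>2 * (p $ 2)\<^sup>2"
    and "h0 \<Gamma> p $ 2 $ 2 = 2 * ((r (p $ 1))\<^sup>2 + 1)"
    and "h0 \<Gamma> p $ 3 $ 3 = 2 * (p $ 2)\<^sup>2 * ((r (p $ 1))\<^sup>2 + 1)"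
proof -
  let ?s = "p $ 1"
  have s: "?s \<in> I" using assms(2) by (simp add: domain_of_def)
  have "((\<lambda>t. cis (\<theta> t)) has_derivative (\<lambda>h. (\<theta>' * h) *\<^sub>R (\<i> * cis (\<theta> ?s)))) (at ?s)"
    by (rule has_derivative_cis[OF \<theta>[unfolded has_field_derivative_def]])
  from has_derivative_mult[OF has_derivative_of_real[OF r[unfolded has_field_derivative_def]] this]
  have "((\<lambda>t. of_real (r t) * cis (\<theta> t)) has_vector_derivative
      (of_real r' + \<i> * of_real (r ?s * \<theta>')) * cis (\<theta> ?s)) (at ?s)"
    by (simp add: has_vector_derivative_def scaleR_conv_of_real algebra_simps)
  then have "(\<Gamma> has_vector_derivative (of_real r' + \<i> * of_real (r ?s * \<theta>')) * cis (\<theta> ?s)) (at ?s)"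
    by (rule has_vector_derivative_transform_within_open[OF _ assms(1) s]) (simp add: assms(3))
  note P = partial_immersion[OF this]
  have G: "\<Gamma> ?s = of_real (r ?s) * cis (\<theta> ?s)" using assms(3) s .
  have m: "(cis x * a) \<bullet> (cis x * b) = a \<bullet> b" for x a b
  proof -
    have "cis x * cnj (cis x) = 1" by (simp add: cis_cnj cis_mult)
    then have "cis x * a * cnj (cis x * b) = a * cnj b"
      by (metis (no_types, lifting) complex_cnj_mult mult.assoc mult.commute mult_1)
    moreover have "u \<bullet> v = Re (u * cnj v)" for u v :: complex by (simp add: inner_complex_def)
    ultimately show ?thesis by metis
  qed
  define c where "c = cis (p $ 3) * cis (\<theta> ?s)"
  have cm: "(c * a) \<bullet> (c * b) = a \<bullet> b" for a b
    by (simp add: c_def m mult.assoc)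
  have P1: "partial 1 (immersion \<Gamma>) p = vector [c * (of_real (p $ 2) * (of_real r' + \<i> * of_real (r ?s * \<theta>'))), 0]"
    and P2: "partial 2 (immersion \<Gamma>) p = vector [c * of_real (r ?s), cis (p $ 3) * 1]"
    and P3: "partial 3 (immersion \<Gamma>) p = vector [c * (\<i> * of_real (p $ 2) * of_real (r ?s)), cis (p $ 3) * (\<i> * of_real (p $ 2))]"
    by (simp_all add: P G c_def mult_ac)
  show "h0 \<Gamma> p $ 1 $ 2 = 2 * r ?s * r' * p $ 2"
    "h0 \<Gamma> p $ 1 $ 3 = 2 * \<theta>' * (r ?s)\<^sup>2 * (p $ 2)\<^sup>2"
    "h0 \<Gamma> p $ 2 $ 2 = 2 * ((r ?s)\<^sup>2 + 1)"
    "h0 \<Gamma> p $ 3 $ 3 = 2 * (p $ 2)\<^sup>2 * ((r ?s)\<^sup>2 + 1)"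
    by (simp_all add: h0_def g0_flat P1 P2 P3 inner_vec_def[where 'b=2] sum_2 cm m del: mult_1_right)
       (simp_all add: inner_complex_def power2_eq_square algebra_simps)
qed

text \<open>A spinor field is a smooth \<open>\<complex>\<^sup>2\<close>-valued function of the point \<open>\<plusminus>(z\<^sub>1,z\<^sub>2)\<close> of the hypersurface,
  written in the coordinates. (Where the image of \<open>\<Gamma>\<close> crosses itself, this asks for the same
  value on both sheets.)\<close>

definition spinor_field :: "(real \<Rightarrow> complex) \<Rightarrow> real set \<Rightarrow> (real^3 \<Rightarrow> complex^2) \<Rightarrow> bool" where
  "spinor_field \<Gamma> I \<psi> \<longleftrightarrow> smooth_on (domain_of I) \<psi> \<and>
     (\<forall>p\<in>domain_of I. \<forall>q\<in>domain_of I.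
        immersion \<Gamma> q = immersion \<Gamma> p \<or> immersion \<Gamma> q = - immersion \<Gamma> p \<longrightarrow> \<psi> q = \<psi> p)"

definition WK_spinor ::
  "(real \<Rightarrow> complex) \<Rightarrow> real set \<Rightarrow> real \<Rightarrow> (real^3 \<Rightarrow> complex^2) \<Rightarrow> bool" where
  "WK_spinor \<Gamma> I lam \<psi> \<longleftrightarrow>
     (let g = h0 \<Gamma>; S = scalar_curvature g; cl = clifford g (frame \<Gamma>) in
      spinor_field \<Gamma> I \<psi> \<and> (\<exists>p\<in>domain_of I. \<psi> p \<noteq> 0) \<and>
      (\<forall>p\<in>domain_of I. S p \<noteq> 0) \<and>
      (\<forall>p\<in>domain_of I. \<forall>X.
         (4 * S p) *\<^sub>R spin_derivative g (frame \<Gamma>) X \<psi> p =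
           (3 * frechet_derivative S (at p) X) *\<^sub>R \<psi> p
           + (4 * lam) *\<^sub>R cl p (2 *\<^sub>R ricci_endo g p X - S p *\<^sub>R X) (\<psi> p)
           + cl p X (cl p (gradient g S p) (\<psi> p))))"

text \<open>\<open>\<epsilon> = 1\<close> for positive and \<open>\<epsilon> = - 1\<close> for negative Einstein spinors.\<close>

definition Einstein_spinor ::
  "(real \<Rightarrow> complex) \<Rightarrow> real set \<Rightarrow> real \<Rightarrow> (real^3 \<Rightarrow> complex^2) \<Rightarrow> bool" where
  "Einstein_spinor \<Gamma> I lam \<psi> \<longleftrightarrow>
     (let g = h0 \<Gamma> in
      spinor_field \<Gamma> I \<psi> \<and> (\<exists>p\<in>domain_of I. \<psi> p \<noteq> 0) \<and>
      (\<forall>p\<in>domain_of I. dirac g (frame \<Gamma>) \<psi> p = lam *\<^sub>R \<psi> p) \<and>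
      (\<exists>\<epsilon>\<in>{1, - 1}. \<forall>p\<in>domain_of I. \<forall>X Z.
         metric (ricci g p) X Z - 1/2 * scalar_curvature g p * metric (g p) X Z =
           \<epsilon> * (1/4) * energy_momentum g (frame \<Gamma>) \<psi> p X Z))"

definition psi :: "(real \<Rightarrow> complex) \<Rightarrow> real \<Rightarrow> real^3 \<Rightarrow> complex^2" where
  "psi \<Gamma> lam p =
     (let r = cmod (\<Gamma> (p $ 1)); \<rho> = p $ 2 in
      (1 / (\<rho> * sqrt (r\<^sup>2 + 1))) *\<^sub>R
        vector [exp (- \<i> * of_real (lam * sqrt (2 * (r\<^sup>2 + 1)) * \<rho>)),
                exp (\<i> * of_real (lam * sqrt (2 * (r\<^sup>2 + 1)) * \<rho>))])"

definition psi_normalized :: "(real \<Rightarrow> complex) \<Rightarrow> real \<Rightarrow> real^3 \<Rightarrow> complex^2" where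
  "psi_normalized \<Gamma> lam p =
     sqrt (- scalar_curvature (h0 \<Gamma>) p / (\<bar>lam\<bar> * (norm (psi \<Gamma> lam p))\<^sup>2)) *\<^sub>R psi \<Gamma> lam p"

end

theory Submission
  imports Defs
begin

text \<open>
  Put \<open>w = r\<^sup>2 + 1\<close>, \<open>A = \<langle>\<Gamma>, \<Gamma>'\<rangle>\<close>, \<open>B = det (\<Gamma>, \<Gamma>')\<close> and let \<open>\<kappa>\<close> be the curvature of \<open>\<Gamma>\<close>, so that
  \<open>A' = 1 - \<kappa> B\<close>, \<open>B' = \<kappa> A\<close> and, by unit speed, \<open>w = 1 + A\<^sup>2 + B\<^sup>2\<close>. With \<open>R = \<rho> (2 w)\<^bsup>1/2\<^esup>\<close> the
  coframe dual to \<open>Y\<^sub>1, Y\<^sub>2, Y\<^sub>3\<close> is \<open>dR\<close>, \<open>R (d\<phi> + B/w ds)\<close>, \<open>R ds/w\<close>: the hypersurface is a metric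
  cone over a flat surface. Hence \<open>Ric = - R\<^bsup>-2\<^esup> (\<theta>\<^sub>2\<^sup>2 + \<theta>\<^sub>3\<^sup>2)\<close>, \<open>S = - 2 R\<^bsup>-2\<^esup>\<close>, and the connection forms
  are \<open>\<omega>\<^sub>1\<^sub>2 = \<theta>\<^sub>2/R\<close>, \<open>\<omega>\<^sub>1\<^sub>3 = \<theta>\<^sub>3/R\<close>, \<open>\<omega>\<^sub>2\<^sub>3 = 0\<close>. The spinor depends on \<open>R\<close> alone and solves
  \<open>d\<psi>/dR = - \<psi>/R - \<lambda> Y\<^sub>1 \<cdot> \<psi>\<close>; the WK, Dirac and Einstein equations follow from this equation by
  Clifford algebra, the latter with the sign of \<open>\<lambda>\<close>.
\<close>

section \<open>Closure properties of iterated differentiability\<close>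

text \<open>Near \<open>x\<close> both functions admit the same derivatives \<open>D\<close>,
  possibly none, and \<open>frechet_derivative\<close> is chosen by this property alone.\<close>

lemma frechet_derivative_cong_open:
  assumes "open U" "x \<in> U" "\<And>y. y \<in> U \<Longrightarrow> f y = g y"
  shows "frechet_derivative f (at x) = frechet_derivative g (at x)"
proof -
  have "(f has_derivative D) (at x) \<longleftrightarrow> (g has_derivative D) (at x)" for D
    using has_derivative_transform_within_open[OF _ assms(1,2)] assms(3) by metis
  then show ?thesis
    by (simp add: frechet_derivative_def)
qed

lemma times_differentiable_on_Suc_imp:
  "times_differentiable_on (Suc n) U f \<Longrightarrow> times_differentiable_on n U f"
proof (induction n arbitrary: f)
  case 0
  then show ?case
    by (auto intro!: continuous_at_imp_continuous_on differentiable_imp_continuous_within)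
next
  case (Suc n)
  then show ?case
    by (metis times_differentiable_on.simps(2))
qed

lemma times_differentiable_on_cong:
  assumes "open U" "\<And>x. x \<in> U \<Longrightarrow> f x = g x"
  shows "times_differentiable_on n U f \<longleftrightarrow> times_differentiable_on n U g"
  using assms(2)
proof (induction n arbitrary: f g)
  case 0
  then show ?case using continuous_on_cong by auto
next
  case (Suc n)
  have "f differentiable at x \<longleftrightarrow> g differentiable at x" if "x \<in> U" for x
    using has_derivative_transform_within_open[OF _ assms(1) that] Suc.prems
    unfolding differentiable_def by metis
  moreover have "times_differentiable_on n U (\<lambda>x. frechet_derivative f (at x) v) \<longleftrightarrow>
      times_differentiable_on n U (\<lambda>x. frechet_derivative g (at x) v)" for v
    by (rule Suc.IH) (simp add: frechet_derivative_cong_open[OF assms(1) _ Suc.prems])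
  ultimately show ?case by auto
qed

text \<open>Lets an explicit derivative \<open>D\<close>, known only on \<open>U\<close>, replace
  the chosen one in the recursion; openness of \<open>U\<close> makes the exchange valid at every
  order.\<close>

lemma times_differentiable_on_SucI:
  assumes "open U" "\<And>x. x \<in> U \<Longrightarrow> (f has_derivative D x) (at x)"
    and "\<And>v. times_differentiable_on n U (\<lambda>x. D x v)"
  shows "times_differentiable_on (Suc n) U f"
proof -
  have "times_differentiable_on n U (\<lambda>x. frechet_derivative f (at x) v)" for v
    using assms(3)
    by (subst times_differentiable_on_cong[OF assms(1), of _ "\<lambda>x. D x v"])
      (simp_all flip: frechet_derivative_at[OF assms(2)])
  then show ?thesis using assms(2) by (auto simp: differentiable_def)
qed

section \<open>Constants, linear maps, sums, products and compositions\<close>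

lemma times_differentiable_on_const:
  assumes "open U"
  shows "times_differentiable_on n U (\<lambda>_. c)"
proof (induction n arbitrary: c)
  case (Suc n)
  then show ?case by (intro times_differentiable_on_SucI[OF assms has_derivative_const])
qed simp

lemma times_differentiable_on_bounded_linear:
  assumes "open U" "bounded_linear f"
  shows "times_differentiable_on n U f"
proof (cases n)
  case 0
  then show ?thesis by (simp add: assms(2) linear_continuous_on)
next
  case (Suc m)
  show ?thesis
    unfolding Suc
    by (rule times_differentiable_on_SucI[OF assms(1)])
      (auto intro: bounded_linear_imp_has_derivative assms times_differentiable_on_const)
qed

lemma times_differentiable_on_add:
  assumes "open U"
  shows "times_differentiable_on n U f \<Longrightarrow> times_differentiable_on n U g \<Longrightarrow>
    times_differentiable_on n U (\<lambda>x. f x + g x)"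
proof (induction n arbitrary: f g)
  case 0
  then show ?case by (simp add: continuous_on_add)
next
  case (Suc n)
  show ?case
  proof (rule times_differentiable_on_SucI[OF assms])
    show "((\<lambda>x. f x + g x) has_derivative
        (\<lambda>v. frechet_derivative f (at x) v + frechet_derivative g (at x) v)) (at x)" if "x \<in> U" for x
      using Suc.prems that by (auto intro!: has_derivative_add simp flip: frechet_derivative_works)
  qed (use Suc in auto)
qed

lemma (in bounded_linear) times_differentiable_on:
  assumes "open U"
  shows "times_differentiable_on n U g \<Longrightarrow> times_differentiable_on n U (\<lambda>x. f (g x))"
proof (induction n arbitrary: g)
  case 0
  then show ?case by (simp add: continuous_on)
next
  case (Suc n)
  show ?case
  proof (rule times_differentiable_on_SucI[OF assms])
    show "((\<lambda>x. f (g x)) has_derivative (\<lambda>v. f (frechet_derivative g (at x) v))) (at x)"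
      if "x \<in> U" for x
      using Suc.prems that by (auto intro!: has_derivative simp flip: frechet_derivative_works)
  qed (use Suc in auto)
qed

lemma (in bounded_bilinear) times_differentiable_on:
  assumes "open U"
  shows "times_differentiable_on n U f \<Longrightarrow> times_differentiable_on n U g \<Longrightarrow>
    times_differentiable_on n U (\<lambda>x. prod (f x) (g x))"
proof (induction n arbitrary: f g)
  case 0
  then show ?case by (simp add: continuous_on)
next
  case (Suc n)
  show ?case
  proof (rule times_differentiable_on_SucI[OF assms])
    show "((\<lambda>x. prod (f x) (g x)) has_derivative (\<lambda>v. prod (f x) (frechet_derivative g (at x) v)
        + prod (frechet_derivative f (at x) v) (g x))) (at x)" if "x \<in> U" for x
      using Suc.prems that by (auto intro!: FDERIV simp flip: frechet_derivative_works)
    \<comment> \<open>Each summand keeps one factor undifferentiated, so the original functions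
      enter at order \<open>n\<close> as well.\<close>
    show "times_differentiable_on n U (\<lambda>x. prod (f x) (frechet_derivative g (at x) v)
        + prod (frechet_derivative f (at x) v) (g x))" for v
      using Suc.prems times_differentiable_on_Suc_imp[OF Suc.prems(1)]
        times_differentiable_on_Suc_imp[OF Suc.prems(2)]
      by (intro times_differentiable_on_add[OF assms] Suc.IH) auto
  qed
qed

text \<open>As \<open>f\<close> is real valued, the derivative of the composite is the derivative of
  \<open>f\<close> times \<open>h'\<close> at \<open>f x\<close>. The second factor is again a
  composite with the same \<open>f\<close>, so the induction varies only \<open>h\<close>.\<close>

lemma times_differentiable_on_compose_real:
  fixes f :: "'a::real_normed_vector \<Rightarrow> real"
  assumes "open U" "f ` U \<subseteq> V"
  shows "times_differentiable_on n U f \<Longrightarrow> times_differentiable_on n V h \<Longrightarrow>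
    times_differentiable_on n U (\<lambda>x. h (f x))"
proof (induction n arbitrary: h)
  case 0
  then show ?case using assms(2) by (auto intro: continuous_on_compose2)
next
  case (Suc n)
  show ?case
  proof (rule times_differentiable_on_SucI[OF assms(1)])
    fix x assume x: "x \<in> U"
    then have h: "(h has_derivative frechet_derivative h (at (f x))) (at (f x))"
      using Suc.prems assms(2) by (auto simp flip: frechet_derivative_works)
    have chain: "((\<lambda>x. h (f x)) has_derivative
        (\<lambda>v. frechet_derivative h (at (f x)) (frechet_derivative f (at x) v))) (at x)"
      using has_derivative_compose[of f "frechet_derivative f (at x)" x UNIV h, OF _ h] Suc.prems(1) x
      by (simp flip: frechet_derivative_works)
    have linear: "frechet_derivative h (at (f x)) t = t *\<^sub>R frechet_derivative h (at (f x)) 1" for t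
      using linear_cmul[OF has_derivative_linear[OF h], of t 1] by simp
    show "((\<lambda>x. h (f x)) has_derivative
        (\<lambda>v. frechet_derivative f (at x) v *\<^sub>R frechet_derivative h (at (f x)) 1)) (at x)"
      unfolding linear[symmetric] by (rule chain)
  next
    show "times_differentiable_on n U
        (\<lambda>x. frechet_derivative f (at x) v *\<^sub>R frechet_derivative h (at (f x)) 1)" for v
      using Suc.prems
      by (intro bounded_bilinear.times_differentiable_on[OF bounded_bilinear_scaleR assms(1)]
          Suc.IH[OF times_differentiable_on_Suc_imp, of "\<lambda>y. frechet_derivative h (at y) 1"]) auto
  qed
qed

lemma times_differentiable_on_Suc_realI:
  fixes f :: "real \<Rightarrow> 'a::real_normed_vector"
  assumes "open U" "\<And>x. x \<in> U \<Longrightarrow> (f has_vector_derivative f' x) (at x)"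
    and "times_differentiable_on n U f'"
  shows "times_differentiable_on (Suc n) U f"
proof (rule times_differentiable_on_SucI[OF assms(1) assms(2)[unfolded has_vector_derivative_def]])
  show "times_differentiable_on n U (\<lambda>x. v *\<^sub>R f' x)" for v
    by (intro bounded_bilinear.times_differentiable_on[OF bounded_bilinear_scaleR assms(1)]
      times_differentiable_on_const[OF assms(1)] assms(3))
qed

section \<open>Smoothness of the inverse and of the square root on the positive half-line\<close>

lemma smooth_on_inverse: "smooth_on {0<..} (inverse :: real \<Rightarrow> real)"
  unfolding smooth_on_def
proof
  fix n
  show "times_differentiable_on n {0<..} (inverse :: real \<Rightarrow> real)"
  proof (induction n)
    case 0
    then show ?case by (auto intro!: continuous_intros)
  next
    case (Suc n)
    show ?case
    proof (rule times_differentiable_on_Suc_realI)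
      \<comment> \<open>The derivative is a polynomial in \<open>inverse\<close> itself, so the
        induction closes by the product rule.\<close>
      show "(inverse has_vector_derivative (- 1) * (inverse x * inverse x)) (at x)"
        if "x \<in> {0<..}" for x :: real
        using DERIV_inverse[of x UNIV] that
        by (simp add: has_real_derivative_iff_has_vector_derivative power2_eq_square)
      show "times_differentiable_on n {0<..} (\<lambda>x::real. (- 1) * (inverse x * inverse x))"
        by (intro bounded_bilinear.times_differentiable_on[OF bounded_bilinear_mult]
            times_differentiable_on_const Suc) auto
    qed auto
  qed
qed

lemma smooth_on_sqrt: "smooth_on {0<..} sqrt"
  unfolding smooth_on_def
proof
  fix n
  show "times_differentiable_on n {0<..} sqrt"
  proof (induction n)
    case 0
    then show ?case by (auto intro!: continuous_intros)
  next
    case (Suc n)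
    show ?case
    proof (rule times_differentiable_on_Suc_realI)
      \<comment> \<open>The derivative is half of \<open>inverse\<close> composed with
        \<open>sqrt\<close>, which the induction hypothesis covers at order
        \<open>n\<close>.\<close>
      show "(sqrt has_vector_derivative inverse (sqrt x) * (1 / 2)) (at x)" if "x \<in> {0<..}" for x
        using DERIV_real_sqrt[of x] that
        by (simp add: has_real_derivative_iff_has_vector_derivative field_simps)
      show "times_differentiable_on n {0<..} (\<lambda>x. inverse (sqrt x) * (1 / 2))"
        by (intro bounded_bilinear.times_differentiable_on[OF bounded_bilinear_mult]
            times_differentiable_on_const times_differentiable_on_compose_real[OF _ _ Suc, of "{0<..}"]
            smooth_on_inverse[unfolded smooth_on_def, rule_format]) auto
    qed auto
  qed
qed

lemma smooth_on_real_has_vector_derivative: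
  fixes f :: "real \<Rightarrow> 'a::real_normed_vector"
  assumes "smooth_on U f" "x \<in> U"
  shows "(f has_vector_derivative frechet_derivative f (at x) 1) (at x)"
proof -
  have "f differentiable at x"
    using assms by (metis smooth_on_def times_differentiable_on.simps(2))
  then have f: "(f has_derivative frechet_derivative f (at x)) (at x)"
    by (simp add: frechet_derivative_works)
  have "frechet_derivative f (at x) t = t *\<^sub>R frechet_derivative f (at x) 1" for t
    using linear_cmul[OF has_derivative_linear[OF f], of t 1] by simp
  then have "frechet_derivative f (at x) = (\<lambda>t. t *\<^sub>R frechet_derivative f (at x) 1)" by blast
  then show ?thesis using f by (simp add: has_vector_derivative_def)
qed

lemma smooth_on_frechet_derivative:
  "smooth_on U f \<Longrightarrow> smooth_on U (\<lambda>x. frechet_derivative f (at x) v)"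
  unfolding smooth_on_def by (metis times_differentiable_on.simps(2))

section \<open>The curvature of the cone metric\<close>

lemma partial_eqI:
  assumes "(f has_derivative D) (at p)"
  shows "partial i f p = D (axis i 1)"
  using frechet_derivative_at[OF assms] by (simp add: partial_def)

lemma partial_cong:
  assumes "open U" "p \<in> U" "\<And>q. q \<in> U \<Longrightarrow> f q = g q"
  shows "partial i f p = partial i g p"
  using frechet_derivative_cong_open[OF assms] by (simp add: partial_def)

lemma open_domain_of:
  assumes "open I"
  shows "open (domain_of I)"
proof -
  have "domain_of I = (\<lambda>p. p $ 1) -` I \<inter> (\<lambda>p. p $ 2) -` {0<..}"
    by (auto simp: domain_of_def)
  moreover have "open ((\<lambda>p::real^3. p $ 1) -` I)" "open ((\<lambda>p::real^3. p $ 2) -` {0<..})"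
    by (auto intro!: open_vimage assms continuous_intros)
  ultimately show ?thesis by auto
qed

lemma has_derivative_nth [derivative_intros]:
  "((\<lambda>q::real^3. q $ k) has_derivative (\<lambda>h. h $ k)) (at p)"
  by (rule bounded_linear_imp_has_derivative[OF bounded_linear_vec_nth])

text \<open>A one-sided inverse of a square matrix is two-sided, so the choice behind
  \<open>matrix_inv\<close> yields a genuine inverse, which can be cancelled against
  \<open>M\<close>.\<close>

lemma matrix_inv_eqI:
  fixes M N :: "real^'n^'n"
  assumes "M ** N = mat 1"
  shows "matrix_inv M = N"
proof -
  have "M ** matrix_inv M = mat 1 \<and> matrix_inv M ** M = mat 1"
    unfolding matrix_inv_def
    by (rule someI[of _ N]) (simp add: assms matrix_left_right_inverse[of N])
  then have "matrix_inv M ** (M ** N) = N" by (simp add: matrix_mul_assoc)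
  then show ?thesis by (simp add: assms)
qed

text \<open>The matrix of \<open>h0\<close> in the coordinates \<open>(s, \<rho>, \<phi>)\<close>
  for a unit speed curve, with \<open>a\<close>, \<open>b\<close> the values of \<open>A\<close>,
  \<open>B\<close>. As a function of three numbers it separates the algebra from the
  calculus.\<close>

definition cone_matrix :: "real \<Rightarrow> real \<Rightarrow> real \<Rightarrow> real^3^3" where
  "cone_matrix a b \<rho> = vector [
     vector [2 * \<rho>\<^sup>2, 2 * \<rho> * a, 2 * \<rho>\<^sup>2 * b],
     vector [2 * \<rho> * a, 2 * (1 + a\<^sup>2 + b\<^sup>2), 0],
     vector [2 * \<rho>\<^sup>2 * b, 0, 2 * \<rho>\<^sup>2 * (1 + a\<^sup>2 + b\<^sup>2)]]"

text \<open>The adjugate of \<open>cone_matrix\<close> divided by the determinant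
  \<open>8 * \<rho>^4 * w\<close>.\<close>

definition cone_inverse :: "real \<Rightarrow> real \<Rightarrow> real \<Rightarrow> real^3^3" where
  "cone_inverse a b \<rho> = (let w = 1 + a\<^sup>2 + b\<^sup>2 in vector [
     vector [w / (2 * \<rho>\<^sup>2), - a / (2 * \<rho>), - b / (2 * \<rho>\<^sup>2)],
     vector [- a / (2 * \<rho>), (1 + a\<^sup>2) / (2 * w), a * b / (2 * w * \<rho>)],
     vector [- b / (2 * \<rho>\<^sup>2), a * b / (2 * w * \<rho>), (1 + b\<^sup>2) / (2 * w * \<rho>\<^sup>2)]])"

lemma matrix_inv_cone_matrix:
  assumes "\<rho> \<noteq> 0"
  shows "matrix_inv (cone_matrix a b \<rho>) = cone_inverse a b \<rho>"
proof (rule matrix_inv_eqI)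
  have "1 + a\<^sup>2 + b\<^sup>2 > 0" by (smt (verit) zero_le_power2)
  then show "cone_matrix a b \<rho> ** cone_inverse a b \<rho> = mat 1"
    using assms
    by (simp add: vec_eq_iff forall_3 matrix_matrix_mult_def sum_3 mat_def cone_matrix_def
        cone_inverse_def Let_def divide_simps) (simp add: algebra_simps power2_eq_square power4_eq_xxxx)
qed

text \<open>The entry \<open>$ k $ i $ j\<close> is \<open>\<Gamma>\<^sup>k\<^sub>i\<^sub>j\<close>. The table is the pullback of the Christoffel symbols of the
  cone \<open>dR\<^sup>2 + R\<^sup>2 (d\<alpha>\<^sup>2 + dt\<^sup>2)\<close> under \<open>d\<alpha> = d\<phi> + B/w ds\<close>, \<open>dt = ds/w\<close>.\<close>

definition cone_christoffel :: "real \<Rightarrow> real \<Rightarrow> real \<Rightarrow> real \<Rightarrow> real^3^3^3" where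
  "cone_christoffel \<kappa> a b \<rho> = (let w = 1 + a\<^sup>2 + b\<^sup>2 in vector [
     vector [vector [0, 1 / \<rho>, 0], vector [1 / \<rho>, 0, 0], vector [0, 0, 0]],
     vector [vector [- \<rho> * \<kappa> * b / w, 0, - \<rho> * b / w], vector [0, 0, 0], vector [- \<rho> * b / w, 0, - \<rho>]],
     vector [vector [\<kappa> * a / w, 0, a / w], vector [0, 0, 1 / \<rho>], vector [a / w, 1 / \<rho>, 0]]])"

text \<open>The curve enters the intrinsic geometry only through these two differential equations; they give
  \<open>w' = 2 A\<close> for \<open>w = 1 + A\<^sup>2 + B\<^sup>2\<close>.\<close>

locale cone_metric =
  fixes I :: "real set" and A B \<kappa> :: "real \<Rightarrow> real" and g :: "real^3 \<Rightarrow> real^3^3"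
  assumes open_I: "open I"
    and A': "s \<in> I \<Longrightarrow> (A has_real_derivative 1 - \<kappa> s * B s) (at s)"
    and B': "s \<in> I \<Longrightarrow> (B has_real_derivative \<kappa> s * A s) (at s)"
    and differentiable_\<kappa>: "s \<in> I \<Longrightarrow> \<kappa> differentiable at s"
    and g_eq: "p \<in> domain_of I \<Longrightarrow> g p = cone_matrix (A (p $ 1)) (B (p $ 1)) (p $ 2)"
begin

abbreviation w :: "real \<Rightarrow> real" where
  "w s \<equiv> 1 + (A s)\<^sup>2 + (B s)\<^sup>2"

lemma w_pos: "w s > 0"
  by (smt (verit) zero_le_power2)

lemma has_derivative_coordinate:
  assumes "(f has_real_derivative d) (at (p $ 1))"
  shows "((\<lambda>q::real^3. f (q $ 1)) has_derivative (\<lambda>h. d * h $ 1)) (at p)"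
  using has_derivative_compose[OF has_derivative_nth[of 1 p] assms[unfolded has_field_derivative_def]]
  by simp

context
  fixes p :: "real^3"
  assumes p: "p \<in> domain_of I"
begin

lemma param_mem: "p $ 1 \<in> I" and rho_pos: "p $ 2 > 0"
  using p by (auto simp: domain_of_def)

lemmas has_derivative_A = has_derivative_coordinate[of A, OF A'[OF param_mem]]
  and has_derivative_B = has_derivative_coordinate[of B, OF B'[OF param_mem]]

lemma has_derivative_\<kappa>:
  "((\<lambda>q::real^3. \<kappa> (q $ 1)) has_derivative (\<lambda>h. deriv \<kappa> (p $ 1) * h $ 1)) (at p)"
  by (rule has_derivative_coordinate)
    (use differentiable_\<kappa>[OF param_mem] DERIV_deriv_iff_real_differentiable in blast)

text \<open>Entrywise differential of the metric. The identity \<open>w' = 2 A\<close> enters the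
  last two diagonal entries, where \<kappa> cancels.\<close>

lemma has_derivative_cone_matrix:
  "((\<lambda>q. cone_matrix (A (q $ 1)) (B (q $ 1)) (q $ 2) $ j $ k) has_derivative
    (\<lambda>h. (vector [
      vector [4 * p$2 * h$2, 2 * h$2 * A (p$1) + 2 * p$2 * h$1 * (1 - \<kappa> (p$1) * B (p$1)),
        4 * p$2 * h$2 * B (p$1) + 2 * (p$2)\<^sup>2 * h$1 * \<kappa> (p$1) * A (p$1)],
      vector [2 * h$2 * A (p$1) + 2 * p$2 * h$1 * (1 - \<kappa> (p$1) * B (p$1)), 4 * h$1 * A (p$1), 0],
      vector [4 * p$2 * h$2 * B (p$1) + 2 * (p$2)\<^sup>2 * h$1 * \<kappa> (p$1) * A (p$1), 0,
        4 * p$2 * h$2 * w (p$1) + 4 * (p$2)\<^sup>2 * h$1 * A (p$1)]] :: real^3^3) $ j $ k)) (at p)"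
proof -
  have 1: "((\<lambda>q::real^3. 2 * (q $ 2)\<^sup>2) has_derivative (\<lambda>h. 4 * p$2 * h$2)) (at p)"
    by (auto intro!: derivative_eq_intros)
  have 2: "((\<lambda>q::real^3. 2 * q $ 2 * A (q $ 1)) has_derivative
      (\<lambda>h. 2 * h$2 * A (p$1) + 2 * p$2 * h$1 * (1 - \<kappa> (p$1) * B (p$1)))) (at p)"
    by (auto intro!: derivative_eq_intros has_derivative_A simp: fun_eq_iff algebra_simps)
  have 3: "((\<lambda>q::real^3. 2 * (q $ 2)\<^sup>2 * B (q $ 1)) has_derivative
      (\<lambda>h. 4 * p$2 * h$2 * B (p$1) + 2 * (p$2)\<^sup>2 * h$1 * \<kappa> (p$1) * A (p$1))) (at p)"
    by (auto intro!: derivative_eq_intros has_derivative_B simp: fun_eq_iff algebra_simps)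
  have 4: "((\<lambda>q::real^3. 2 * w (q $ 1)) has_derivative (\<lambda>h. 4 * h$1 * A (p$1))) (at p)"
    by (auto intro!: derivative_eq_intros has_derivative_A has_derivative_B simp: fun_eq_iff algebra_simps)
  have 5: "((\<lambda>q::real^3. 2 * (q $ 2)\<^sup>2 * w (q $ 1)) has_derivative
      (\<lambda>h. 4 * p$2 * h$2 * w (p$1) + 4 * (p$2)\<^sup>2 * h$1 * A (p$1))) (at p)"
    by (auto intro!: derivative_eq_intros has_derivative_A has_derivative_B simp: fun_eq_iff algebra_simps)
  show ?thesis
    using exhaust_3[of j] exhaust_3[of k] 1 2 3 4 5
    by (elim disjE) (simp_all only: cone_matrix_def vector_3 has_derivative_const)
qed

lemma christoffel_eq:
  "christoffel g k i j p = cone_christoffel (\<kappa> (p$1)) (A (p$1)) (B (p$1)) (p$2) $ k $ i $ j"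
proof -
  \<comment> \<open>The formula for \<open>g\<close> holds on the open domain only, which is enough
    for partial derivatives at \<open>p\<close>.\<close>
  have P: "partial i (\<lambda>q. g q $ j $ k) p =
      partial i (\<lambda>q. cone_matrix (A (q $ 1)) (B (q $ 1)) (q $ 2) $ j $ k) p" for i j k
    by (rule partial_cong[OF open_domain_of[OF open_I] p]) (simp add: g_eq)
  have w: "w (p$1) \<noteq> 0" using w_pos[of "p$1"] by simp
  show ?thesis
    using exhaust_3[of i] exhaust_3[of j] exhaust_3[of k]
    unfolding christoffel_def P partial_eqI[OF has_derivative_cone_matrix] sum_3 g_eq[OF p]
    using w rho_pos
    by (elim disjE; simp add: matrix_inv_cone_matrix axis_def cone_inverse_def cone_christoffel_def
        Let_def divide_simps; simp add: algebra_simps power2_eq_square power4_eq_xxxx)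
qed

end

section \<open>Curvature and Ricci tensor in coordinates\<close>

lemma levi_civita_nth:
  assumes "p \<in> domain_of I"
  shows "levi_civita g X Y p $ k = (\<Sum>i\<in>UNIV. X $ i * (partial i (\<lambda>q. Y q $ k) p +
    (\<Sum>j\<in>UNIV. cone_christoffel (\<kappa> (p$1)) (A (p$1)) (B (p$1)) (p$2) $ k $ i $ j * Y p $ j)))"
  by (simp add: levi_civita_def christoffel_eq[OF assms])

lemma levi_civita_coordinate:
  assumes "p \<in> domain_of I"
  shows "levi_civita g (axis i 1) (\<lambda>_. axis j 1) p $ k =
    cone_christoffel (\<kappa> (p$1)) (A (p$1)) (B (p$1)) (p$2) $ k $ i $ j"
proof -
  have "partial l (\<lambda>q. axis j 1 $ k) p = (0::real)" for l
    by (rule partial_eqI[OF has_derivative_const])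
  then show ?thesis
    using exhaust_3[of i] exhaust_3[of j]
    by (auto simp: levi_civita_nth[OF assms] sum_3 axis_def)
qed

text \<open>The classical formula in Christoffel symbols: a coordinate field differentiates to a
  column of symbols throughout the domain, and this column is differentiated once more.\<close>

lemma curvature_nth:
  fixes p :: "real^3"
  assumes p: "p \<in> domain_of I"
  defines "C \<equiv> \<lambda>q. cone_christoffel (\<kappa> (q$1)) (A (q$1)) (B (q$1)) (q$2)"
  shows "curvature g i j k p $ l =
    partial i (\<lambda>q. C q $ l $ j $ k) p - partial j (\<lambda>q. C q $ l $ i $ k) p +
    (\<Sum>m\<in>UNIV. C p $ l $ i $ m * C p $ m $ j $ k - C p $ l $ j $ m * C p $ m $ i $ k)"
proof -
  have P: "partial a (\<lambda>q. levi_civita g (axis b 1) (\<lambda>_. axis k 1) q $ l) p =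
      partial a (\<lambda>q. C q $ l $ b $ k) p" for a b
    by (rule partial_cong[OF open_domain_of[OF open_I] p]) (simp add: C_def levi_civita_coordinate)
  have S: "(\<Sum>n\<in>UNIV. axis a 1 $ n * f n) = f a" for a :: 3 and f :: "3 \<Rightarrow> real"
    using exhaust_3[of a] by (auto simp: sum_3 axis_def)
  have "levi_civita g (axis a 1) (levi_civita g (axis b 1) (\<lambda>_. axis k 1)) p $ l =
      partial a (\<lambda>q. C q $ l $ b $ k) p + (\<Sum>m\<in>UNIV. C p $ l $ a $ m * C p $ m $ b $ k)" for a b
    by (subst levi_civita_nth[OF p]) (simp add: S P levi_civita_coordinate[OF p] C_def)
  then show ?thesis
    by (simp add: curvature_def sum_subtractf)
qed

context
  fixes p :: "real^3"
  assumes p: "p \<in> domain_of I"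
begin

text \<open>Differential of the table of Christoffel symbols. The derivative \<open>k'\<close> of
  the curvature of the curve appears here and cancels in the Ricci tensor.\<close>

lemma has_derivative_cone_christoffel:
  defines "k' \<equiv> deriv \<kappa> (p$1)" and "k \<equiv> \<kappa> (p$1)" and "a \<equiv> A (p$1)" and "b \<equiv> B (p$1)"
  shows "((\<lambda>q. cone_christoffel (\<kappa> (q $ 1)) (A (q $ 1)) (B (q $ 1)) (q $ 2) $ l $ i $ j) has_derivative
    (\<lambda>h. (vector [
      vector [vector [0, - h$2 / (p$2)\<^sup>2, 0], vector [- h$2 / (p$2)\<^sup>2, 0, 0], vector [0, 0, 0]],
      vector [
        vector [- h$2 * k * b / w (p$1) - p$2 * h$1 *
            (k' * b / w (p$1) + k\<^sup>2 * a / w (p$1) - 2 * k * a * b / (w (p$1))\<^sup>2),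
          0, - h$2 * b / w (p$1) - p$2 * h$1 * (k * a / w (p$1) - 2 * a * b / (w (p$1))\<^sup>2)],
        vector [0, 0, 0],
        vector [- h$2 * b / w (p$1) - p$2 * h$1 * (k * a / w (p$1) - 2 * a * b / (w (p$1))\<^sup>2),
          0, - h$2]],
      vector [
        vector [h$1 * (k' * a / w (p$1) + k * (1 - k * b) / w (p$1) - 2 * k * a\<^sup>2 / (w (p$1))\<^sup>2),
          0, h$1 * ((1 - k * b) / w (p$1) - 2 * a\<^sup>2 / (w (p$1))\<^sup>2)],
        vector [0, 0, - h$2 / (p$2)\<^sup>2],
        vector [h$1 * ((1 - k * b) / w (p$1) - 2 * a\<^sup>2 / (w (p$1))\<^sup>2), - h$2 / (p$2)\<^sup>2, 0]]]
      :: real^3^3^3) $ l $ i $ j)) (at p)"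
proof -
  note d = has_derivative_A[OF p, folded k_def a_def b_def] has_derivative_B[OF p, folded k_def a_def b_def]
    has_derivative_\<kappa>[OF p, folded k'_def]
  have w: "w (p$1) \<noteq> 0" "w (p$1) = 1 + a\<^sup>2 + b\<^sup>2"
    using w_pos[of "p$1"] by (simp_all add: a_def b_def)
  have has_derivative_w: "((\<lambda>q. w (q$1)) has_derivative (\<lambda>h. 2 * a * h$1)) (at p)"
    by (auto intro!: derivative_eq_intros d simp: fun_eq_iff algebra_simps simp flip: a_def b_def)
  note d = d has_derivative_w
  have 1: "((\<lambda>q::real^3. 1 / q $ 2) has_derivative (\<lambda>h. - h$2 / (p$2)\<^sup>2)) (at p)"
    using rho_pos[OF p] by (auto intro!: derivative_eq_intros simp: fun_eq_iff power2_eq_square)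
  have 2: "((\<lambda>q::real^3. - q $ 2 * \<kappa> (q$1) * B (q$1) / w (q$1)) has_derivative
      (\<lambda>h. - h$2 * k * b / w (p$1) - p$2 * h$1 *
            (k' * b / w (p$1) + k\<^sup>2 * a / w (p$1) - 2 * k * a * b / (w (p$1))\<^sup>2))) (at p)"
    by (rule derivative_eq_intros d refl w)+
      (use w(1) in \<open>simp add: fun_eq_iff divide_simps power2_eq_square flip: a_def b_def k_def;
        simp add: algebra_simps\<close>)
  have 3: "((\<lambda>q::real^3. - q $ 2 * B (q$1) / w (q$1)) has_derivative
      (\<lambda>h. - h$2 * b / w (p$1) - p$2 * h$1 * (k * a / w (p$1) - 2 * a * b / (w (p$1))\<^sup>2))) (at p)"
    by (rule derivative_eq_intros d refl w)+
      (use w(1) in \<open>simp add: fun_eq_iff divide_simps power2_eq_square flip: a_def b_def k_def;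
        simp add: algebra_simps\<close>)
  have 4: "((\<lambda>q::real^3. - q $ 2) has_derivative (\<lambda>h. - h$2)) (at p)"
    by (auto intro!: derivative_eq_intros)
  have 5: "((\<lambda>q::real^3. \<kappa> (q$1) * A (q$1) / w (q$1)) has_derivative
      (\<lambda>h. h$1 * (k' * a / w (p$1) + k * (1 - k * b) / w (p$1) - 2 * k * a\<^sup>2 / (w (p$1))\<^sup>2))) (at p)"
    by (rule derivative_eq_intros d refl w)+
      (use w(1) in \<open>simp add: fun_eq_iff divide_simps power2_eq_square flip: a_def b_def k_def;
        simp add: algebra_simps\<close>)
  have 6: "((\<lambda>q::real^3. A (q$1) / w (q$1)) has_derivative
      (\<lambda>h. h$1 * ((1 - k * b) / w (p$1) - 2 * a\<^sup>2 / (w (p$1))\<^sup>2))) (at p)"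
    by (rule derivative_eq_intros d refl w)+
      (use w(1) in \<open>simp add: fun_eq_iff divide_simps power2_eq_square flip: a_def b_def k_def;
        simp add: algebra_simps\<close>)
  show ?thesis
    using exhaust_3[of l] exhaust_3[of i] exhaust_3[of j] 1 2 3 4 5 6
    by (elim disjE) (simp_all only: cone_christoffel_def Let_def vector_3 has_derivative_const)
qed

text \<open>A three-dimensional cone over a surface of Gauss curvature \<open>K\<close> has Ricci
  tensor \<open>K - 1\<close> times the metric of the surface. Here \<open>K = 0\<close>, and the
  matrix is that of \<open>- (d\<alpha>\<^sup>2 + dt\<^sup>2)\<close>.\<close>

lemma ricci_eq:
  "ricci g p = (let b = B (p$1); w = w (p$1) in
    vector [vector [- (1 + b\<^sup>2) / w\<^sup>2, 0, - b / w], vector [0, 0, 0], vector [- b / w, 0, - 1]])"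
proof -
  have "w (p$1) \<noteq> 0" "p$2 \<noteq> 0" using w_pos[of "p$1"] rho_pos[OF p] by simp_all
  then show ?thesis
    unfolding vec_eq_iff forall_3 ricci_def curvature_nth[OF p]
       partial_eqI[OF has_derivative_cone_christoffel]
    by (intro conjI; simp add: Let_def sum_3 axis_def cone_christoffel_def; (simp add: divide_simps)?;
      (simp add: algebra_simps power2_eq_square)?)
qed

end
end

section \<open>The frame, its connection forms and spinors\<close>

lemma clifford_matrix_mult:
  "clifford_matrix 1 *v \<phi> = vector [\<i> * \<phi> $ 1, - \<i> * \<phi> $ 2]"
  "clifford_matrix 2 *v \<phi> = vector [\<i> * \<phi> $ 2, \<i> * \<phi> $ 1]"
  "clifford_matrix 3 *v \<phi> = vector [- \<phi> $ 2, \<phi> $ 1]"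
  by (simp_all add: clifford_matrix_def vec_eq_iff forall_2 matrix_vector_mult_def sum_2)

section \<open>Scalar curvature, its gradient, and the orthonormal coframe\<close>

context cone_metric
begin

text \<open>The length of the coordinate field of \<rho>; hence \<open>\<rho> * W\<close> is the
  distance \<open>R\<close> from the apex of the cone.\<close>

definition W :: "real \<Rightarrow> real" where
  "W s = sqrt (2 * w s)"

abbreviation radius :: "real^3 \<Rightarrow> real" where
  "radius p \<equiv> p $ 2 * W (p $ 1)"

lemma W_pos: "W s > 0"
  using w_pos[of s] by (simp add: W_def)

lemma W_sq: "W s * W s = 2 * (1 + A s * A s + B s * B s)"
  using w_pos[of s] by (simp add: W_def flip: power2_eq_square)

lemma w_eq_W: "w s = (W s)\<^sup>2 / 2"
  using W_sq[of s] by (simp add: power2_eq_square)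

context
  fixes p :: "real^3"
  assumes p: "p \<in> domain_of I"
begin

lemma scalar_curvature_eq: "scalar_curvature g p = - 1 / ((p$2)\<^sup>2 * w (p$1))"
proof -
  have "w (p$1) \<noteq> 0" "p$2 \<noteq> 0" using w_pos[of "p$1"] rho_pos[OF p] by simp_all
  then show ?thesis
    using rho_pos[OF p]
    by (simp add: scalar_curvature_def sum_3 ricci_eq[OF p] g_eq[OF p] matrix_inv_cone_matrix
        cone_inverse_def Let_def divide_simps) (simp add: algebra_simps power2_eq_square)
qed

lemma ricci_endo_eq:
  "ricci_endo g p X =
    - (1 / (2 * (p$2)\<^sup>2 * w (p$1))) *\<^sub>R vector [X$1, - p$2 * A (p$1) * X$1 / w (p$1), X$3]"
proof -
  have "w (p$1) \<noteq> 0" "p$2 \<noteq> 0" using w_pos[of "p$1"] rho_pos[OF p] by simp_all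
  then show ?thesis
    using rho_pos[OF p]
    by (simp add: ricci_endo_def sum_3 ricci_eq[OF p] g_eq[OF p] matrix_inv_cone_matrix
        cone_inverse_def Let_def matrix_vector_mult_def vec_eq_iff forall_3 divide_simps)
       (simp add: algebra_simps power2_eq_square)
qed

lemma has_derivative_w: "((\<lambda>q. w (q$1)) has_derivative (\<lambda>h. 2 * A (p$1) * h$1)) (at p)"
  by (auto intro!: derivative_eq_intros has_derivative_A[OF p] has_derivative_B[OF p] simp: fun_eq_iff algebra_simps)

lemma has_derivative_W: "((\<lambda>q. W (q$1)) has_derivative (\<lambda>h. 2 * A (p$1) / W (p$1) * h$1)) (at p)"
proof -
  have "((\<lambda>q. 2 * w (q$1)) has_derivative (\<lambda>h. 2 * (2 * A (p$1) * h$1))) (at p)"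
    by (rule has_derivative_mult_right[OF has_derivative_w])
  from has_derivative_real_sqrt[OF _ this] w_pos[of "p$1"] show ?thesis
    by (auto simp: W_def fun_eq_iff field_simps elim!: has_derivative_eq_rhs)
qed

end

lemma has_derivative_scalar_curvature:
  assumes p: "p \<in> domain_of I"
  shows "(scalar_curvature g has_derivative
    (\<lambda>h. 2 * h$2 / ((p$2)^3 * w (p$1)) + 2 * A (p$1) * h$1 / ((p$2)\<^sup>2 * (w (p$1))\<^sup>2))) (at p)"
proof (rule has_derivative_transform_within_open[OF _ open_domain_of[OF open_I] p])
  define v where "v = w (p$1)"
  have v: "v \<noteq> 0" "p$2 \<noteq> 0" using w_pos[of "p$1"] rho_pos[OF p] by (simp_all add: v_def)
  have "((\<lambda>q::real^3. (q$2)\<^sup>2) has_derivative (\<lambda>h. 2 * p$2 * h$2)) (at p)"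
    by (auto intro!: derivative_eq_intros)
  from has_derivative_mult[OF this has_derivative_w[OF p]]
  have d: "((\<lambda>q. (q$2)\<^sup>2 * w (q$1)) has_derivative
      (\<lambda>h. (p$2)\<^sup>2 * (2 * A (p$1) * h$1) + 2 * p$2 * h$2 * v)) (at p)"
    by (simp add: v_def)
  show "((\<lambda>q. - 1 / ((q$2)\<^sup>2 * w (q$1))) has_derivative
    (\<lambda>h. 2 * h$2 / ((p$2)^3 * w (p$1)) + 2 * A (p$1) * h$1 / ((p$2)\<^sup>2 * (w (p$1))\<^sup>2))) (at p)"
  proof (rule has_derivative_eq_rhs[OF has_derivative_divide[OF has_derivative_const[of "- 1"] d]],
      unfold v_def[symmetric])
  qed (use v in \<open>simp_all add: fun_eq_iff divide_simps eval_nat_numeral, simp_all add: algebra_simps\<close>)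
qed (simp add: scalar_curvature_eq)

text \<open>The scalar curvature is a function of \<open>R\<close> alone, so its gradient is radial,
  a multiple of the coordinate field of \<rho>.\<close>

lemma gradient_scalar_curvature:
  assumes p: "p \<in> domain_of I"
  shows "gradient g (scalar_curvature g) p = vector [0, 1 / ((p$2)^3 * (w (p$1))\<^sup>2), 0]"
proof -
  have "w (p$1) \<noteq> 0" "p$2 \<noteq> 0" using w_pos[of "p$1"] rho_pos[OF p] by simp_all
  then show ?thesis
    using rho_pos[OF p]
    by (simp add: gradient_def sum_3 g_eq[OF p] matrix_inv_cone_matrix axis_def
        partial_eqI[OF has_derivative_scalar_curvature[OF p]]
        cone_inverse_def Let_def matrix_vector_mult_def vec_eq_iff forall_3 divide_simps)
       (simp add: algebra_simps eval_nat_numeral)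
qed

text \<open>The forms \<open>dR\<close>, \<open>R (d\<phi> + B/w ds)\<close> and
  \<open>R ds/w\<close>, with \<open>w\<close> expressed as half the square of
  \<open>W\<close>.\<close>

definition coframe :: "3 \<Rightarrow> real^3 \<Rightarrow> real^3 \<Rightarrow> real" where
  "coframe i p X =
    (if i = 1 then W (p$1) * X$2 + 2 * p$2 * A (p$1) / W (p$1) * X$1
     else if i = 2 then p$2 * W (p$1) * X$3 + 2 * p$2 * B (p$1) / W (p$1) * X$1
     else 2 * p$2 / W (p$1) * X$1)"

lemma coframe_simps:
  "coframe 1 p X = W (p$1) * X$2 + 2 * p$2 * A (p$1) / W (p$1) * X$1"
  "coframe 2 p X = p$2 * W (p$1) * X$3 + 2 * p$2 * B (p$1) / W (p$1) * X$1"
  "coframe 3 p X = 2 * p$2 / W (p$1) * X$1"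
  by (simp_all add: coframe_def)

text \<open>Exhibits the coframe as orthonormal; the cross terms match because the square of
  \<open>W\<close> is \<open>2 * w\<close>.\<close>

lemma metric_eq:
  assumes "p \<in> domain_of I"
  shows "metric (g p) X Z = (\<Sum>i\<in>UNIV. coframe i p X * coframe i p Z)"
proof -
  have "W (p$1) \<noteq> 0" using W_pos[of "p$1"] by simp
  then show ?thesis
    by (simp add: metric_def g_eq[OF assms] cone_matrix_def coframe_simps sum_3 divide_simps
        power2_eq_square; use W_sq[of "p$1"] in algebra)
qed

lemma metric_ricci_eq:
  assumes "p \<in> domain_of I"
  shows "metric (ricci g p) X Z =
    - (coframe 2 p X * coframe 2 p Z + coframe 3 p X * coframe 3 p Z) / (radius p)\<^sup>2"
  using W_pos[of "p$1"] rho_pos[OF assms]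
  by (simp add: metric_def ricci_eq[OF assms, unfolded Let_def w_eq_W] coframe_simps sum_3
      divide_simps) (simp add: algebra_simps eval_nat_numeral)

end

locale cone_spin = cone_metric +
  fixes Y :: "3 \<Rightarrow> real^3 \<Rightarrow> real^3"
  assumes Y1: "p \<in> domain_of I \<Longrightarrow> Y 1 p = vector [0, 1 / W (p$1), 0]"
    and Y2: "p \<in> domain_of I \<Longrightarrow> Y 2 p = vector [0, 0, 1 / (p$2 * W (p$1))]"
    and Y3: "p \<in> domain_of I \<Longrightarrow>
      Y 3 p = vector [W (p$1) / (2 * p$2), - A (p$1) / W (p$1), - B (p$1) / (p$2 * W (p$1))]"
begin

section \<open>Covariant derivatives of the frame and the spin connection\<close>

context
  fixes p :: "real^3"
  assumes p: "p \<in> domain_of I"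
begin

lemma coframe_frame: "coframe i p (Y j p) = (if i = j then 1 else 0)"
  using W_pos[of "p$1"] rho_pos[OF p] exhaust_3[of i] exhaust_3[of j]
  by (elim disjE) (simp_all add: coframe_simps Y1 Y2 Y3 p)

text \<open>Duality of frame and coframe reduces Clifford multiplication and the connection forms to
  values of \<open>coframe\<close>.\<close>

lemma metric_frame: "metric (g p) X (Y i p) = coframe i p X"
  using exhaust_3[of i] by (elim disjE) (simp_all add: metric_eq[OF p] sum_3 coframe_frame)

text \<open>On a cone, the derivative of the radial unit field along \<open>X\<close> is the part of
  \<open>X\<close> orthogonal to that field, divided by \<open>R\<close>; these are its
  coordinates.\<close>

lemma levi_civita_Y1:
  "levi_civita g X (Y 1) p =
    vector [X$1 / radius p, - 2 * A (p$1) * X$1 / (W (p$1))^3, X$3 / radius p]"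
proof -
  have "partial i (\<lambda>q. Y 1 q $ k) p = partial i (\<lambda>q. vector [0, 1 / W (q$1), 0] $ k) p" for i k
    by (rule partial_cong[OF open_domain_of[OF open_I] p]) (simp add: Y1)
  moreover have "((\<lambda>q. 1 / W (q$1)) has_derivative (\<lambda>h. - 2 * A (p$1) / (W (p$1))^3 * h$1)) (at p)"
    by (rule has_derivative_W[OF p] derivative_eq_intros refl)+
      (use W_pos[of "p$1"] in \<open>auto simp: fun_eq_iff field_simps power3_eq_cube power2_eq_square\<close>)
  ultimately have P: "partial i (\<lambda>q. Y 1 q $ k) p =
      (if k = 2 then - 2 * A (p$1) / (W (p$1))^3 * axis i 1 $ 1 else 0)" for i k
    using exhaust_3[of k] by (auto simp: partial_eqI[OF has_derivative_const] dest!: partial_eqI[of _ _ p i])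
  show ?thesis
    using W_pos[of "p$1"] rho_pos[OF p]
    by (simp add: vec_eq_iff forall_3 levi_civita_nth[OF p] P sum_3 axis_def Y1[OF p]
        cone_christoffel_def Let_def)
qed

text \<open>The value is \<open>- coframe 2 p X / radius p\<close> times \<open>Y 1 p\<close>: the
  direction is parallel in the flat surface, so only the radial term of the cone connection is
  left.\<close>

lemma levi_civita_Y2:
  "levi_civita g X (Y 2) p = vector [0, - (X$3 + 2 * B (p$1) * X$1 / (W (p$1))\<^sup>2) / W (p$1), 0]"
proof -
  have "partial i (\<lambda>q. Y 2 q $ k) p = partial i (\<lambda>q. vector [0, 0, 1 / radius q] $ k) p" for i k
    by (rule partial_cong[OF open_domain_of[OF open_I] p]) (simp add: Y2)
  moreover have "((\<lambda>q. 1 / radius q) has_derivative (\<lambda>h. - 2 * A (p$1) / (p$2 * (W (p$1))^3) * h$1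
      - h$2 / ((p$2)\<^sup>2 * W (p$1)))) (at p)"
    by (rule has_derivative_W[OF p] derivative_eq_intros refl)+
      (use W_pos[of "p$1"] rho_pos[OF p] in \<open>auto simp: fun_eq_iff field_simps power3_eq_cube power2_eq_square\<close>)
  ultimately have P: "partial i (\<lambda>q. Y 2 q $ k) p =
      (if k = 3 then - 2 * A (p$1) / (p$2 * (W (p$1))^3) * axis i 1 $ 1
      - axis i 1 $ 2 / ((p$2)\<^sup>2 * W (p$1)) else 0)" for i k
    using exhaust_3[of k] by (auto simp: partial_eqI[OF has_derivative_const] dest!: partial_eqI[of _ _ p i])
  note C = cone_christoffel_def[of "\<kappa> (p$1)" "A (p$1)" "B (p$1)" "p$2",
      unfolded Let_def w_eq_W]
  show ?thesis
    using W_pos[of "p$1"] rho_pos[OF p]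
    by (simp add: vec_eq_iff forall_3 levi_civita_nth[OF p] P sum_3 axis_def Y2[OF p] C divide_simps)
      (simp add: algebra_simps eval_nat_numeral)
qed

end

lemma connection_forms:
  assumes p: "p \<in> domain_of I"
  shows "metric (g p) (levi_civita g X (Y 1) p) (Y 2 p) = coframe 2 p X / radius p"
    and "metric (g p) (levi_civita g X (Y 1) p) (Y 3 p) = coframe 3 p X / radius p"
    and "metric (g p) (levi_civita g X (Y 2) p) (Y 3 p) = 0"
  using W_pos[of "p$1"] rho_pos[OF p]
  by (simp_all add: metric_frame[OF p] levi_civita_Y1[OF p] levi_civita_Y2[OF p] coframe_simps
      field_simps)

text \<open>The Clifford relations \<open>Y\<^sub>1 Y\<^sub>2 = Y\<^sub>3\<close> and
  \<open>Y\<^sub>1 Y\<^sub>3 = - Y\<^sub>2\<close> turn each product in the connection term into a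
  single matrix, and \<open>\<omega>\<^sub>2\<^sub>3\<close> vanishes.\<close>

lemma spin_derivative_eq:
  assumes p: "p \<in> domain_of I" and D: "(\<psi> has_derivative D) (at p)"
  shows "spin_derivative g Y X \<psi> p = D X + (1 / (2 * radius p)) *\<^sub>R
    (coframe 2 p X *\<^sub>R (clifford_matrix 3 *v \<psi> p) - coframe 3 p X *\<^sub>R (clifford_matrix 2 *v \<psi> p))"
proof -
  have "clifford_matrix 1 *v (clifford_matrix 2 *v \<phi>) = clifford_matrix 3 *v \<phi>"
    "clifford_matrix 1 *v (clifford_matrix 3 *v \<phi>) = - (clifford_matrix 2 *v \<phi>)" for \<phi>
    by (simp_all only: clifford_matrix_mult vec_eq_iff forall_2 vector_2 vector_uminus_component) simp_all
  then show ?thesis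
    unfolding spin_derivative_def frechet_derivative_at[OF D, symmetric]
    by (simp add: connection_forms[OF p] scaleR_right_diff_distrib)
qed

lemma clifford_eq:
  assumes "p \<in> domain_of I"
  shows "clifford g Y p X \<phi> = (\<Sum>i\<in>UNIV. coframe i p X *\<^sub>R (clifford_matrix i *v \<phi>))"
  by (simp add: clifford_def metric_frame[OF assms])

lemma scalar_curvature_radius:
  assumes "p \<in> domain_of I"
  shows "scalar_curvature g p = - 2 / (radius p)\<^sup>2"
  unfolding scalar_curvature_eq[OF assms] w_eq_W by (simp add: power_mult_distrib)

lemma coframe_gradient_scalar_curvature:
  assumes "p \<in> domain_of I"
  shows "coframe i p (gradient g (scalar_curvature g) p) = (if i = 1 then 4 / (radius p)^3 else 0)"
  using exhaust_3[of i] W_pos[of "p$1"] rho_pos[OF assms]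
  unfolding gradient_scalar_curvature[OF assms] w_eq_W
  by (elim disjE) (simp_all add: coframe_simps field_simps eval_nat_numeral)

lemma frechet_derivative_scalar_curvature:
  assumes "p \<in> domain_of I"
  shows "frechet_derivative (scalar_curvature g) (at p) X = 4 / (radius p)^3 * coframe 1 p X"
  using W_pos[of "p$1"] rho_pos[OF assms]
  unfolding frechet_derivative_at[OF has_derivative_scalar_curvature[OF assms], symmetric] w_eq_W
  by (simp add: coframe_simps field_simps eval_nat_numeral)

text \<open>In the frame the Ricci endomorphism is diagonal with entries \<open>0\<close>,
  \<open>- 1/R\<^sup>2\<close>, \<open>- 1/R\<^sup>2\<close>, and subtracting
  \<open>S = - 2/R\<^sup>2\<close> from its double leaves only the radial entry.\<close>

lemma coframe_ricci_endo:
  assumes "p \<in> domain_of I"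
  shows "coframe i p (2 *\<^sub>R ricci_endo g p X - scalar_curvature g p *\<^sub>R X) =
    (if i = 1 then 2 / (radius p)\<^sup>2 * coframe 1 p X else 0)"
  using exhaust_3[of i] W_pos[of "p$1"] rho_pos[OF assms]
  unfolding ricci_endo_eq[OF assms] scalar_curvature_radius[OF assms] w_eq_W
  by (elim disjE) (simp_all add: coframe_simps field_simps eval_nat_numeral)

section \<open>The field equations for spinors that solve the radial equation\<close>

context
  fixes p :: "real^3" and lam :: real and \<psi> :: "real^3 \<Rightarrow> complex^2"
  assumes p: "p \<in> domain_of I"
    and radial: "(\<psi> has_derivative (\<lambda>X. coframe 1 p X *\<^sub>R
      (- (1 / radius p) *\<^sub>R \<psi> p - lam *\<^sub>R (clifford_matrix 1 *v \<psi> p)))) (at p)"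
begin

lemma radius_pos: "radius p > 0"
  using W_pos[of "p$1"] rho_pos[OF p] by simp

text \<open>Along \<open>Y 1\<close> the terms in \<open>1/R^3\<close> balance as
  \<open>8 = 12 - 4\<close>, and the \<lambda>-terms agree by \<open>coframe_ricci_endo\<close>.
  Along \<open>Y 2\<close> and \<open>Y 3\<close> the spin connection on the left equals the term
  \<open>X \<cdot> dS \<cdot> \<psi>\<close>, since distinct frame vectors anticommute.\<close>

lemma WK_equation:
  "(4 * scalar_curvature g p) *\<^sub>R spin_derivative g Y X \<psi> p =
    (3 * frechet_derivative (scalar_curvature g) (at p) X) *\<^sub>R \<psi> p
    + (4 * lam) *\<^sub>R clifford g Y p (2 *\<^sub>R ricci_endo g p X - scalar_curvature g p *\<^sub>R X) (\<psi> p)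
    + clifford g Y p X (clifford g Y p (gradient g (scalar_curvature g) p) (\<psi> p))"
proof -
  define R x y z where "R = radius p" "x = coframe 1 p X" "y = coframe 2 p X" "z = coframe 3 p X"
  have "R > 0" using radius_pos by (simp add: R_x_y_z_def)
  then show ?thesis
    unfolding spin_derivative_eq[OF p radial] clifford_eq[OF p] sum_3
      coframe_gradient_scalar_curvature[OF p] coframe_ricci_endo[OF p]
    unfolding frechet_derivative_scalar_curvature[OF p] scalar_curvature_radius[OF p]
      R_x_y_z_def[symmetric]
    by (simp add: clifford_matrix_mult vec_eq_iff forall_2 complex_eq_iff)
      (simp add: field_simps eval_nat_numeral)
qed

text \<open>With \<open>Y\<^sub>2 Y\<^sub>3 = Y\<^sub>1\<close> the spin connection contributes
  \<open>Y\<^sub>1 \<cdot> \<psi> / R\<close>, which cancels the term from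
  \<open>- \<psi>/R\<close>; the rest is \<open>- \<lambda> Y\<^sub>1 \<cdot> Y\<^sub>1 \<cdot>
  \<psi> = \<lambda> \<psi>\<close>.\<close>

lemma dirac_eq: "dirac g Y \<psi> p = lam *\<^sub>R \<psi> p"
  using radius_pos
  unfolding dirac_def spin_derivative_eq[OF p radial] sum_3 coframe_frame[OF p]
  by (simp add: clifford_matrix_mult vec_eq_iff forall_2 complex_eq_iff)

text \<open>The Clifford matrices are skew for the real inner product, which removes all terms with
  a single matrix. The spin connection contributes a form antisymmetric in \<open>X\<close>,
  \<open>Z\<close>, removed by symmetrization.\<close>

lemma energy_momentum_eq:
  "energy_momentum g Y \<psi> p X Z = 2 * lam * (norm (\<psi> p))\<^sup>2 * coframe 1 p X * coframe 1 p Z"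
proof -
  define R x y z where "R = radius p" "x = coframe 1 p X" "y = coframe 2 p X" "z = coframe 3 p X"
  define x' y' z' where "x' = coframe 1 p Z" "y' = coframe 2 p Z" "z' = coframe 3 p Z"
  have "R > 0" using radius_pos by (simp add: R_x_y_z_def)
  then show ?thesis
    unfolding energy_momentum_def spin_derivative_eq[OF p radial] clifford_eq[OF p] sum_3
      R_x_y_z_def[symmetric] x'_y'_z'_def[symmetric] power2_norm_eq_inner
    by (simp add: clifford_matrix_mult inner_vec_def sum_2 inner_complex_def)
      (simp add: field_simps eval_nat_numeral)
qed

end

text \<open>Half of \<open>2/R\<^sup>2\<close> times the metric cancels the Ricci part; the rank one
  form that remains is proportional to the energy-momentum form.\<close>

lemma Einstein_equation:
  assumes p: "p \<in> domain_of I"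
  shows "metric (ricci g p) X Z - 1/2 * scalar_curvature g p * metric (g p) X Z =
    coframe 1 p X * coframe 1 p Z / (radius p)\<^sup>2"
  using W_pos[of "p$1"] rho_pos[OF p]
  by (simp add: metric_ricci_eq[OF p] metric_eq[OF p] scalar_curvature_radius[OF p] sum_3 field_simps)

end

section \<open>The spinor of the proposition as a function of the radius\<close>

lemma has_vector_derivative_vecI:
  fixes f :: "real \<Rightarrow> 'a::euclidean_space^'n"
  assumes "\<And>k. ((\<lambda>x. f x $ k) has_vector_derivative v $ k) (at x)"
  shows "(f has_vector_derivative v) (at x)"
  unfolding has_vector_derivative_def
proof (subst has_derivative_componentwise_within, safe)
  fix e :: "'a^'n" assume "e \<in> Basis"
  then obtain k b where "e = axis k b" by (auto simp: Basis_vec_def)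
  then show "((\<lambda>x. f x \<bullet> e) has_derivative (\<lambda>t. (t *\<^sub>R v) \<bullet> e)) (at x)"
    using has_derivative_inner_left[OF assms[unfolded has_vector_derivative_def], of k b]
    by (simp add: inner_axis)
qed

text \<open>The factor arises from
  \<open>1 / (\<rho> * sqrt (r\<^sup>2 + 1)) = sqrt 2 / R\<close>.\<close>

definition radial_spinor :: "real \<Rightarrow> real \<Rightarrow> complex^2" where
  "radial_spinor lam x = (sqrt 2 / x) *\<^sub>R
     vector [exp (- \<i> * of_real (lam * x)), exp (\<i> * of_real (lam * x))]"

text \<open>The matrix of \<open>Y 1\<close> is diagonal with entries \<open>\<i>\<close>,
  \<open>- \<i>\<close>, so the radial equation splits into two scalar ones, treated together with
  exponent \<open>c\<close>.\<close>

lemma radial_spinor_has_vector_derivative: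
  assumes "x > 0"
  shows "(radial_spinor lam has_vector_derivative
    - (1 / x) *\<^sub>R radial_spinor lam x - lam *\<^sub>R (clifford_matrix 1 *v radial_spinor lam x)) (at x)"
proof -
  have "((\<lambda>x. (sqrt 2 / x) *\<^sub>R exp (c * of_real (lam * x))) has_vector_derivative
      - (1 / x) *\<^sub>R ((sqrt 2 / x) *\<^sub>R exp (c * of_real (lam * x)))
      + lam *\<^sub>R (c * ((sqrt 2 / x) *\<^sub>R exp (c * of_real (lam * x))))) (at x)" for c :: complex
  proof -
    have "((\<lambda>x. exp (c * of_real (lam * x))) has_vector_derivative
        (of_real lam * c) * exp (c * of_real (lam * x))) (at x)"
    proof -
      have "((\<lambda>z. exp (c * (of_real lam * z))) has_field_derivative
          (of_real lam * c) * exp (c * of_real (lam * x))) (at (of_real x))"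
        by (auto intro!: derivative_eq_intros)
      from has_vector_derivative_real_field[OF this] show ?thesis by simp
    qed
    moreover have "((\<lambda>x. sqrt 2 / x) has_real_derivative - (1 / x) * (sqrt 2 / x)) (at x)"
      using assms by (auto intro!: derivative_eq_intros)
    ultimately show ?thesis
      using has_vector_derivative_scaleR by (force simp: scaleR_conv_of_real algebra_simps)
  qed
  note d = this[of "- \<i>"] this[of "\<i>"]
  show ?thesis
  proof (rule has_vector_derivative_vecI)
    fix k
    show "((\<lambda>x. radial_spinor lam x $ k) has_vector_derivative (- (1 / x) *\<^sub>R radial_spinor lam x
        - lam *\<^sub>R (clifford_matrix 1 *v radial_spinor lam x)) $ k) (at x)"
      using d exhaust_2[of k]
      by (elim disjE) (simp_all add: radial_spinor_def clifford_matrix_mult)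
  qed
qed

text \<open>Bootstrapping: by the radial equation the derivative is linear in the spinor with smooth
  coefficients, so each order of differentiability yields the next.\<close>

lemma smooth_on_radial_spinor: "smooth_on {0<..} (radial_spinor lam)"
  unfolding smooth_on_def
proof
  fix n
  show "times_differentiable_on n {0<..} (radial_spinor lam)"
  proof (induction n)
    case 0
    then show ?case
      using radial_spinor_has_vector_derivative
      by (auto intro!: continuous_at_imp_continuous_on has_vector_derivative_continuous)
  next
    case (Suc n)
    have "times_differentiable_on n {0<..} (\<lambda>x::real. - inverse x)"
      by (rule bounded_linear.times_differentiable_on[OF bounded_linear_minus[OF bounded_linear_ident]])
        (use smooth_on_inverse in \<open>auto simp: smooth_on_def\<close>)
    moreover have "times_differentiable_on n {0<..} (\<lambda>x::real. - lam)"
      by (rule times_differentiable_on_const) simp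
    moreover have "times_differentiable_on n {0<..} (\<lambda>x. clifford_matrix 1 *v radial_spinor lam x)"
      by (rule bounded_linear.times_differentiable_on[OF matrix_vector_mul_bounded_linear _ Suc]) simp
    ultimately have "times_differentiable_on n {0<..} (\<lambda>x. (- inverse x) *\<^sub>R radial_spinor lam x
        + (- lam) *\<^sub>R (clifford_matrix 1 *v radial_spinor lam x))"
      by (intro times_differentiable_on_add Suc
          bounded_bilinear.times_differentiable_on[OF bounded_bilinear_scaleR]) simp_all
    then show ?case
      by (intro times_differentiable_on_Suc_realI[OF _ radial_spinor_has_vector_derivative])
        (auto simp: divide_inverse)
  qed
qed

section \<open>Unit speed curves\<close>

locale unit_speed_curve =
  fixes \<Gamma> :: "real \<Rightarrow> complex" and I :: "real set"
  assumes open_I: "open I"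
    and smooth: "smooth_on I \<Gamma>"
    and unit_speed: "s \<in> I \<Longrightarrow> norm (vector_derivative \<Gamma> (at s)) = 1"
begin

section \<open>Frenet quantities of the curve\<close>

definition \<Gamma>' :: "real \<Rightarrow> complex" where
  "\<Gamma>' s = frechet_derivative \<Gamma> (at s) 1"

definition \<Gamma>'' :: "real \<Rightarrow> complex" where
  "\<Gamma>'' s = frechet_derivative \<Gamma>' (at s) 1"

text \<open>In polar coordinates \<open>A = r r'\<close> and \<open>B = r\<^sup>2 \<theta>'\<close>;
  the Cartesian form stays meaningful where the curve meets the origin.\<close>

definition A :: "real \<Rightarrow> real" where
  "A s = Re (\<Gamma> s) * Re (\<Gamma>' s) + Im (\<Gamma> s) * Im (\<Gamma>' s)"

definition B :: "real \<Rightarrow> real" where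
  "B s = Re (\<Gamma> s) * Im (\<Gamma>' s) - Im (\<Gamma> s) * Re (\<Gamma>' s)"

definition \<kappa> :: "real \<Rightarrow> real" where
  "\<kappa> s = Re (\<Gamma>' s) * Im (\<Gamma>'' s) - Im (\<Gamma>' s) * Re (\<Gamma>'' s)"

lemma smooth': "smooth_on I \<Gamma>'" and smooth'': "smooth_on I \<Gamma>''"
proof -
  show "smooth_on I \<Gamma>'"
    using smooth_on_frechet_derivative[OF smooth, of 1] by (simp add: \<Gamma>'_def[abs_def])
  then show "smooth_on I \<Gamma>''"
    using smooth_on_frechet_derivative[of I \<Gamma>' 1] by (simp add: \<Gamma>''_def[abs_def])
qed

context
  fixes s :: real
  assumes s: "s \<in> I"
begin

lemma has_vector_derivative_curve: "(\<Gamma> has_vector_derivative \<Gamma>' s) (at s)"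
  using smooth_on_real_has_vector_derivative[OF smooth s] by (simp add: \<Gamma>'_def)

lemma has_vector_derivative_tangent: "(\<Gamma>' has_vector_derivative \<Gamma>'' s) (at s)"
  using smooth_on_real_has_vector_derivative[OF smooth' s] by (simp add: \<Gamma>''_def)

lemma has_vector_derivative_acceleration:
  "(\<Gamma>'' has_vector_derivative frechet_derivative \<Gamma>'' (at s) 1) (at s)"
  using smooth_on_real_has_vector_derivative[OF smooth'' s] .

lemma DERIV_Re:
  "(f has_vector_derivative f') (at s) \<Longrightarrow> ((\<lambda>s. Re (f s)) has_real_derivative Re f') (at s)"
  and DERIV_Im:
  "(f has_vector_derivative f') (at s) \<Longrightarrow> ((\<lambda>s. Im (f s)) has_real_derivative Im f') (at s)"
  unfolding has_real_derivative_iff_has_vector_derivative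
  by (rule bounded_linear.has_vector_derivative[OF bounded_linear_Re]
      bounded_linear.has_vector_derivative[OF bounded_linear_Im]; assumption)+

lemmas DERIV_components =
  DERIV_Re[OF has_vector_derivative_curve] DERIV_Im[OF has_vector_derivative_curve]
  DERIV_Re[OF has_vector_derivative_tangent] DERIV_Im[OF has_vector_derivative_tangent]
  DERIV_Re[OF has_vector_derivative_acceleration] DERIV_Im[OF has_vector_derivative_acceleration]

end

lemma unit_tangent: "s \<in> I \<Longrightarrow> (Re (\<Gamma>' s))\<^sup>2 + (Im (\<Gamma>' s))\<^sup>2 = 1"
  using unit_speed[of s] vector_derivative_at[OF has_vector_derivative_curve, of s]
  by (simp add: norm_complex_def)

text \<open>The Frenet equation \<open>\<Gamma>'' = \<kappa> \<i> \<Gamma>'\<close>: differentiating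
  the constant speed shows that the acceleration is orthogonal to the unit tangent.\<close>

lemma acceleration:
  assumes s: "s \<in> I"
  shows "Re (\<Gamma>'' s) = - \<kappa> s * Im (\<Gamma>' s)" "Im (\<Gamma>'' s) = \<kappa> s * Re (\<Gamma>' s)"
proof -
  have "((\<lambda>s. (Re (\<Gamma>' s))\<^sup>2 + (Im (\<Gamma>' s))\<^sup>2) has_real_derivative
      2 * (Re (\<Gamma>' s) * Re (\<Gamma>'' s) + Im (\<Gamma>' s) * Im (\<Gamma>'' s))) (at s)"
    by (auto intro!: derivative_eq_intros has_vector_derivative_tangent[OF s])
  moreover have "((\<lambda>s. (Re (\<Gamma>' s))\<^sup>2 + (Im (\<Gamma>' s))\<^sup>2) has_real_derivative 0) (at s)"
    by (rule has_field_derivative_transform_within_open[OF DERIV_const[of 1] open_I s])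
      (simp add: unit_tangent)
  ultimately have "Re (\<Gamma>' s) * Re (\<Gamma>'' s) + Im (\<Gamma>' s) * Im (\<Gamma>'' s) = 0"
    using DERIV_unique by fastforce
  with unit_tangent[OF s] show "Re (\<Gamma>'' s) = - \<kappa> s * Im (\<Gamma>' s)" "Im (\<Gamma>'' s) = \<kappa> s * Re (\<Gamma>' s)"
    unfolding \<kappa>_def power2_eq_square by algebra+
qed

text \<open>\<open>A\<close> and \<open>- B\<close> are the components of \<Gamma> in the
  orthonormal basis formed by the unit tangent and its rotation by a right angle.\<close>

lemma w_eq: "s \<in> I \<Longrightarrow> 1 + (A s)\<^sup>2 + (B s)\<^sup>2 = (cmod (\<Gamma> s))\<^sup>2 + 1"
  using unit_tangent[of s] unfolding A_def B_def cmod_power2 by algebra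

text \<open>The ambient metric is twice the flat one, so the common phase drops out and unit speed
  does the rest.\<close>

lemma h0_eq:
  assumes "p \<in> domain_of I"
  shows "h0 \<Gamma> p = cone_matrix (A (p$1)) (B (p$1)) (p$2)"
proof -
  have s: "p$1 \<in> I" using assms by (simp add: domain_of_def)
  show ?thesis
    unfolding vec_eq_iff forall_3 h0_def g0_flat cone_matrix_def
      inner_vec_def[where 'b=2] sum_2 inner_complex_def w_eq[OF s] cmod_power2
    by (simp add: partial_immersion[OF has_vector_derivative_curve[OF s]] A_def B_def power2_eq_square;
      intro conjI; use unit_tangent[OF s] sin_cos_squared_add3[of "p$3"] in
        \<open>(simp only: power2_eq_square)?; (algebra | simp add: algebra_simps)\<close>)
qed

text \<open>The equations for \<open>A\<close> and \<open>B\<close> are the product rule combined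
  with the Frenet equation; \<kappa> is differentiable because it involves two derivatives of a
  smooth curve.\<close>

sublocale cone_metric I A B \<kappa> "h0 \<Gamma>"
proof
  show "open I" by (rule open_I)
next
  fix s assume s: "s \<in> I"
  show "(A has_real_derivative 1 - \<kappa> s * B s) (at s)"
    unfolding A_def[abs_def] B_def
    by (rule DERIV_components[OF s] derivative_eq_intros refl)+
      (use unit_tangent[OF s] acceleration[OF s] in algebra)
  show "(B has_real_derivative \<kappa> s * A s) (at s)"
    unfolding A_def B_def[abs_def]
    by (rule DERIV_components[OF s] derivative_eq_intros refl)+
      (use unit_tangent[OF s] acceleration[OF s] in algebra)
  have "\<exists>d. (\<kappa> has_real_derivative d) (at s)"
    unfolding \<kappa>_def[abs_def]
    by (rule exI) (rule DERIV_components[OF s] derivative_eq_intros refl)+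
  then show "\<kappa> differentiable at s"
    by (simp add: real_differentiable_def)
next
  show "h0 \<Gamma> p = cone_matrix (A (p$1)) (B (p$1)) (p$2)" if "p \<in> domain_of I" for p
    by (rule h0_eq[OF that])
qed

lemma frame_eq:
  assumes p: "p \<in> domain_of I"
  shows "frame \<Gamma> 1 p = vector [0, 1 / W (p$1), 0]"
    and "frame \<Gamma> 2 p = vector [0, 0, 1 / (p$2 * W (p$1))]"
    and "frame \<Gamma> 3 p = vector [W (p$1) / (2 * p$2), - A (p$1) / W (p$1), - B (p$1) / (p$2 * W (p$1))]"
proof -
  have "h0 \<Gamma> p $ 2 $ 2 = (W (p$1))\<^sup>2" "h0 \<Gamma> p $ 3 $ 3 = (p$2 * W (p$1))\<^sup>2"
     "h0 \<Gamma> p $ 1 $ 2 = 2 * p$2 * A (p$1)" "h0 \<Gamma> p $ 1 $ 3 = 2 * (p$2)\<^sup>2 * B (p$1)"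
    using W_sq[of "p$1"] by (simp_all add: h0_eq[OF p] cone_matrix_def power2_eq_square)
  then show "frame \<Gamma> 1 p = vector [0, 1 / W (p$1), 0]"
    "frame \<Gamma> 2 p = vector [0, 0, 1 / (p$2 * W (p$1))]"
    "frame \<Gamma> 3 p = vector [W (p$1) / (2 * p$2), - A (p$1) / W (p$1), - B (p$1) / (p$2 * W (p$1))]"
    using W_pos[of "p$1"] rho_pos[OF p]
    by (simp_all add: frame_def Let_def vec_eq_iff forall_3 axis_def real_sqrt_mult field_simps
        power2_eq_square)
qed

sublocale cone_spin I A B \<kappa> "h0 \<Gamma>" "frame \<Gamma>"
  by unfold_locales (simp_all add: frame_eq)

lemma W_eq: "s \<in> I \<Longrightarrow> W s = sqrt (2 * ((cmod (\<Gamma> s))\<^sup>2 + 1))"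
  by (simp add: W_def w_eq)

lemma psi_eq:
  assumes "p \<in> domain_of I"
  shows "psi \<Gamma> lam p = radial_spinor lam (radius p)"
proof -
  have s: "p$1 \<in> I" using assms by (simp add: domain_of_def)
  show ?thesis
    by (simp add: psi_def Let_def radial_spinor_def W_eq[OF s] real_sqrt_mult mult_ac
        del: distrib_left_numeral)
qed

text \<open>Both exponentials have modulus one, so the squared length is \<open>4/R\<^sup>2\<close>,
  while the scalar curvature is \<open>- 2/R\<^sup>2\<close>.\<close>

lemma norm_psi:
  assumes "p \<in> domain_of I"
  shows "(norm (psi \<Gamma> lam p))\<^sup>2 = - 2 * scalar_curvature (h0 \<Gamma>) p"
proof -
  have "norm (radial_spinor lam x) = 2 / x" if "x > 0" for x
    using that
    by (simp add: radial_spinor_def norm_vec_def L2_set_def sum_2 norm_exp_i_times real_sqrt_divide field_simps)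
  then have "norm (psi \<Gamma> lam p) = 2 / radius p"
    using W_pos[of "p$1"] rho_pos[OF assms] by (simp add: psi_eq[OF assms])
  then show ?thesis
    by (simp add: scalar_curvature_radius[OF assms] power_divide)
qed

text \<open>The identity \<open>dR = \<theta>\<^sub>1\<close>, by which the chain rule turns the
  radial equation into an equation for the spinor field.\<close>

lemma has_derivative_radius:
  assumes p: "p \<in> domain_of I"
  shows "(radius has_derivative coframe 1 p) (at p)"
  by (rule has_derivative_eq_rhs[OF has_derivative_mult[OF has_derivative_nth[of 2 p]
      has_derivative_W[OF p]]])
    (simp add: coframe_simps fun_eq_iff)

lemma psi_has_derivative:
  assumes p: "p \<in> domain_of I"
  shows "(psi \<Gamma> lam has_derivative (\<lambda>X. coframe 1 p X *\<^sub>R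
    (- (1 / radius p) *\<^sub>R psi \<Gamma> lam p - lam *\<^sub>R (clifford_matrix 1 *v psi \<Gamma> lam p)))) (at p)"
proof (rule has_derivative_transform_within_open[OF _ open_domain_of[OF open_I] p])
  have "radius p > 0" using W_pos[of "p$1"] rho_pos[OF p] by simp
  note d = radial_spinor_has_vector_derivative[OF this, of lam, unfolded has_vector_derivative_def]
  show "((\<lambda>q. radial_spinor lam (radius q)) has_derivative (\<lambda>X. coframe 1 p X *\<^sub>R
    (- (1 / radius p) *\<^sub>R psi \<Gamma> lam p - lam *\<^sub>R (clifford_matrix 1 *v psi \<Gamma> lam p)))) (at p)"
    unfolding psi_eq[OF p] by (rule has_derivative_compose[OF has_derivative_radius[OF p] d])
qed (simp add: psi_eq)

lemma spinor_field_psi: "spinor_field \<Gamma> I (psi \<Gamma> lam)"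
  unfolding spinor_field_def
proof (intro conjI ballI impI)
  let ?U = "domain_of I"
  have U: "open ?U" by (rule open_domain_of[OF open_I])
  have "times_differentiable_on n ?U (psi \<Gamma> lam)" for n
  proof -
    have s: "times_differentiable_on n ?U (\<lambda>p. \<Gamma> (p$1))"
      using smooth unfolding smooth_on_def
      by (intro times_differentiable_on_compose_real[OF U _
          times_differentiable_on_bounded_linear[OF U bounded_linear_vec_nth], of _ I])
        (auto simp: domain_of_def)
    \<comment> \<open>The inner product replaces the squared modulus, since the modulus itself is
      not smooth where the curve meets the origin.\<close>
    have w: "times_differentiable_on n ?U (\<lambda>p. 2 * (\<Gamma> (p$1) \<bullet> \<Gamma> (p$1) + 1))"
      by (intro times_differentiable_on_add[OF U] times_differentiable_on_const[OF U] s
          bounded_bilinear.times_differentiable_on[OF bounded_bilinear_inner U]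
          bounded_bilinear.times_differentiable_on[OF bounded_bilinear_mult U])
    have "times_differentiable_on n ?U (\<lambda>p. sqrt (2 * (\<Gamma> (p$1) \<bullet> \<Gamma> (p$1) + 1)))"
      using smooth_on_sqrt unfolding smooth_on_def
      by (intro times_differentiable_on_compose_real[OF U _ w, of "{0<..}"])
        (auto intro: add_nonneg_pos)
    then have r: "times_differentiable_on n ?U (\<lambda>p. p$2 * sqrt (2 * (\<Gamma> (p$1) \<bullet> \<Gamma> (p$1) + 1)))"
      by (intro bounded_bilinear.times_differentiable_on[OF bounded_bilinear_mult U]
         times_differentiable_on_bounded_linear[OF U bounded_linear_vec_nth])
    have "times_differentiable_on n ?U
        (\<lambda>p. radial_spinor lam (p$2 * sqrt (2 * (\<Gamma> (p$1) \<bullet> \<Gamma> (p$1) + 1))))"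
      using smooth_on_radial_spinor unfolding smooth_on_def
      by (intro times_differentiable_on_compose_real[OF U _ r, of "{0<..}"])
        (auto simp: domain_of_def intro!: mult_pos_pos add_nonneg_pos)
    then show ?thesis
      by (rule times_differentiable_on_cong[OF U, THEN iffD1, rotated])
        (simp add: psi_eq W_eq[OF param_mem] power2_norm_eq_inner)
  qed
  then show "smooth_on ?U (psi \<Gamma> lam)" by (simp add: smooth_on_def)
next
  fix p q
  assume p: "p \<in> domain_of I" and q: "q \<in> domain_of I"
    and im: "immersion \<Gamma> q = immersion \<Gamma> p \<or> immersion \<Gamma> q = - immersion \<Gamma> p"
  have pos: "p$2 > 0" "q$2 > 0" using p q by (auto simp: domain_of_def)
  \<comment> \<open>Sign and phase disappear in the moduli of the components, which are
    \<open>\<rho> r\<close> and \<rho>; they determine the spinor.\<close>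
  have n: "cmod (immersion \<Gamma> q $ k) = cmod (immersion \<Gamma> p $ k)" for k
    using im by auto
  have "q$2 = p$2" using n[of 2] pos by (simp add: immersion_def norm_mult)
  moreover have "cmod (\<Gamma> (q$1)) = cmod (\<Gamma> (p$1))"
    using n[of 1] pos calculation by (simp add: immersion_def norm_mult)
  ultimately show "psi \<Gamma> lam q = psi \<Gamma> lam p" by (simp add: psi_def)
qed

lemma psi_nonzero: "p \<in> domain_of I \<Longrightarrow> psi \<Gamma> lam p \<noteq> 0"
  using norm_psi[of p lam] scalar_curvature_radius[of p] W_pos[of "p$1"] rho_pos[of p] by auto

lemma WK_spinor_psi:
  assumes "I \<noteq> {}"
  shows "WK_spinor \<Gamma> I lam (psi \<Gamma> lam)"
proof -
  obtain s where "s \<in> I" using assms by blast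
  then have "(vector [s, 1, 0] :: real^3) \<in> domain_of I" by (simp add: domain_of_def)
  moreover have "scalar_curvature (h0 \<Gamma>) p \<noteq> 0" if "p \<in> domain_of I" for p
    using scalar_curvature_radius[OF that] W_pos[of "p$1"] rho_pos[OF that] by simp
  ultimately show ?thesis
    unfolding WK_spinor_def Let_def
    by (intro conjI ballI allI bexI[of _ "vector [s, 1, 0]"] spinor_field_psi psi_nonzero
        WK_equation[OF _ psi_has_derivative]) simp_all
qed

context
  fixes lam :: real
  assumes lam: "lam \<noteq> 0"
begin

text \<open>The scalar curvature is a fixed multiple of the squared length, so the normalization is
  a constant factor and preserves the linear radial equation.\<close>

lemma psi_normalized_eq:
  assumes "p \<in> domain_of I"
  shows "psi_normalized \<Gamma> lam p = (1 / sqrt (2 * \<bar>lam\<bar>)) *\<^sub>R psi \<Gamma> lam p"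
proof -
  have "norm (psi \<Gamma> lam p) \<noteq> 0" using psi_nonzero[OF assms] by simp
  moreover have "scalar_curvature (h0 \<Gamma>) p = - (norm (psi \<Gamma> lam p))\<^sup>2 / 2"
    using norm_psi[OF assms] by simp
  ultimately have "- scalar_curvature (h0 \<Gamma>) p / (\<bar>lam\<bar> * (norm (psi \<Gamma> lam p))\<^sup>2) = 1 / (2 * \<bar>lam\<bar>)"
    by simp
  then show ?thesis by (simp add: psi_normalized_def real_sqrt_divide)
qed

lemma psi_normalized_formula:
  assumes "p \<in> domain_of I"
  shows "let r = cmod (\<Gamma> (p $ 1)); \<rho> = p $ 2 in
    psi_normalized \<Gamma> lam p = (1 / (\<rho> * sqrt (2 * (r\<^sup>2 + 1) * \<bar>lam\<bar>))) *\<^sub>R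
      vector [exp (- \<i> * of_real (lam * sqrt (2 * (r\<^sup>2 + 1)) * \<rho>)),
              exp (\<i> * of_real (lam * sqrt (2 * (r\<^sup>2 + 1)) * \<rho>))]"
  by (simp add: psi_normalized_eq[OF assms] psi_def Let_def real_sqrt_mult mult_ac
      del: distrib_left_numeral)

lemma psi_normalized_has_derivative:
  assumes p: "p \<in> domain_of I"
  shows "(psi_normalized \<Gamma> lam has_derivative (\<lambda>X. coframe 1 p X *\<^sub>R
    (- (1 / radius p) *\<^sub>R psi_normalized \<Gamma> lam p
      - lam *\<^sub>R (clifford_matrix 1 *v psi_normalized \<Gamma> lam p)))) (at p)"
proof (rule has_derivative_transform_within_open[OF _ open_domain_of[OF open_I] p])
  show "((\<lambda>q. (1 / sqrt (2 * \<bar>lam\<bar>)) *\<^sub>R psi \<Gamma> lam q) has_derivative (\<lambda>X. coframe 1 p X *\<^sub>R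
    (- (1 / radius p) *\<^sub>R psi_normalized \<Gamma> lam p
      - lam *\<^sub>R (clifford_matrix 1 *v psi_normalized \<Gamma> lam p)))) (at p)"
    unfolding psi_normalized_eq[OF p]
    by (rule has_derivative_eq_rhs[OF has_derivative_scaleR_right[OF psi_has_derivative[OF p]]])
      (simp add: fun_eq_iff algebra_simps
        linear_cmul[OF bounded_linear.linear[OF matrix_vector_mul_bounded_linear]])
qed (simp add: psi_normalized_eq)

lemma spinor_field_psi_normalized: "spinor_field \<Gamma> I (psi_normalized \<Gamma> lam)"
proof -
  have psi: "smooth_on (domain_of I) (psi \<Gamma> lam)"
    "\<And>p q. p \<in> domain_of I \<Longrightarrow> q \<in> domain_of I \<Longrightarrow>
      immersion \<Gamma> q = immersion \<Gamma> p \<or> immersion \<Gamma> q = - immersion \<Gamma> p \<Longrightarrow> psi \<Gamma> lam q = psi \<Gamma> lam p"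
    using spinor_field_psi[of lam] unfolding spinor_field_def by blast+
  have "times_differentiable_on n (domain_of I) (\<lambda>p. (1 / sqrt (2 * \<bar>lam\<bar>)) *\<^sub>R psi \<Gamma> lam p)" for n
    using psi(1) unfolding smooth_on_def
    by (intro bounded_linear.times_differentiable_on[OF bounded_linear_scaleR_right
          open_domain_of[OF open_I]]) blast
  then have "smooth_on (domain_of I) (psi_normalized \<Gamma> lam)"
    using times_differentiable_on_cong[OF open_domain_of[OF open_I], of "psi_normalized \<Gamma> lam"
        "\<lambda>p. (1 / sqrt (2 * \<bar>lam\<bar>)) *\<^sub>R psi \<Gamma> lam p"] psi_normalized_eq
    unfolding smooth_on_def by blast
  moreover have "psi_normalized \<Gamma> lam q = psi_normalized \<Gamma> lam p"
    if "p \<in> domain_of I" "q \<in> domain_of I"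
      "immersion \<Gamma> q = immersion \<Gamma> p \<or> immersion \<Gamma> q = - immersion \<Gamma> p" for p q
    unfolding psi_normalized_eq[OF that(1)] psi_normalized_eq[OF that(2)] psi(2)[OF that] ..
  ultimately show ?thesis
    unfolding spinor_field_def by blast
qed

lemma Einstein_spinor_psi_normalized:
  assumes "I \<noteq> {}"
  shows "Einstein_spinor \<Gamma> I lam (psi_normalized \<Gamma> lam)"
proof -
  obtain s where "s \<in> I" using assms by blast
  then have "(vector [s, 1, 0] :: real^3) \<in> domain_of I" by (simp add: domain_of_def)
  moreover have "psi_normalized \<Gamma> lam p \<noteq> 0" if "p \<in> domain_of I" for p
    using psi_nonzero[OF that] lam by (simp add: psi_normalized_eq[OF that])
  \<comment> \<open>The squared length \<open>2 / (R\<^sup>2 \<bar>\<lambda>\<bar>)\<close> turns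
    the factor \<lambda> of the energy-momentum form into the sign of \<lambda>, which serves as
    \<open>\<epsilon>\<close>.\<close>
  moreover have "metric (ricci (h0 \<Gamma>) p) X Z - 1/2 * scalar_curvature (h0 \<Gamma>) p * metric (h0 \<Gamma> p) X Z =
      sgn lam * (1/4) * energy_momentum (h0 \<Gamma>) (frame \<Gamma>) (psi_normalized \<Gamma> lam) p X Z"
    if p: "p \<in> domain_of I" for p X Z
  proof -
    have "(norm (psi_normalized \<Gamma> lam p))\<^sup>2 = 2 / ((radius p)\<^sup>2 * \<bar>lam\<bar>)"
      using lam norm_psi[OF p, of lam]
      by (simp add: psi_normalized_eq[OF p] scalar_curvature_radius[OF p] power_mult_distrib
          power_divide)
    then show ?thesis
      unfolding Einstein_equation[OF p] energy_momentum_eq[OF p psi_normalized_has_derivative[OF p]]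
      using lam by (simp add: sgn_if)
  qed
  moreover have "sgn lam \<in> {1, - 1}" using lam by (simp add: sgn_if)
  ultimately show ?thesis
    unfolding Einstein_spinor_def Let_def
    by (intro conjI ballI allI bexI[of _ "vector [s, 1, 0]"] bexI[of _ "sgn lam"]
        spinor_field_psi_normalized dirac_eq[OF _ psi_normalized_has_derivative]) simp_all
qed

end

end

theorem proposition16:
  fixes \<Gamma> :: "real \<Rightarrow> complex" and I :: "real set" and lam :: real
  assumes "open I" "is_interval I" "I \<noteq> {}"
    and "smooth_on I \<Gamma>"
    and "\<forall>s\<in>I. norm (vector_derivative \<Gamma> (at s)) = 1"
  shows "WK_spinor \<Gamma> I lam (psi \<Gamma> lam) \<and>
    (\<forall>p\<in>domain_of I. (norm (psi \<Gamma> lam p))\<^sup>2 = - 2 * scalar_curvature (h0 \<Gamma>) p) \<and>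
    (lam \<noteq> 0 \<longrightarrow>
      (\<forall>p\<in>domain_of I.
         let r = cmod (\<Gamma> (p $ 1)); \<rho> = p $ 2 in
         psi_normalized \<Gamma> lam p =
           (1 / (\<rho> * sqrt (2 * (r\<^sup>2 + 1) * \<bar>lam\<bar>))) *\<^sub>R
             vector [exp (- \<i> * of_real (lam * sqrt (2 * (r\<^sup>2 + 1)) * \<rho>)),
                     exp (\<i> * of_real (lam * sqrt (2 * (r\<^sup>2 + 1)) * \<rho>))]) \<and>
      Einstein_spinor \<Gamma> I lam (psi_normalized \<Gamma> lam))"
proof -
  interpret unit_speed_curve \<Gamma> I
    using assms by unfold_locales auto
  show ?thesis
    by (intro conjI impI ballI WK_spinor_psi norm_psi psi_normalized_formula
        Einstein_spinor_psi_normalized assms(3))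
qed

end
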